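(* Assume there exists a semisimple complex Lie algebra of dimension $n$. Let $[\mu]\in L_n$. Then $F_n:L_n\to\mathbb{R}$ attains its minimum value at a point $[\lambda]\in\mathrm{GL}(n).[\mu]$ if and only if $\mu$ is semisimple. In such a case, $F_n([\lambda])=\frac{4}{n}$.
   Context: Let $V_n=\Lambda^2(\mathbb{C}^n)^*\otimes\mathbb{C}^n$ be the space of alternating bilinear maps $\mathbb{C}^n\times\mathbb{C}^n\to\mathbb{C}^n$, with $\mathrm{GL}(n)=\mathrm{GL}(n,\mathbb{C})$ acting by $g.\mu(X,Y)=g\mu(g^{-1}X,g^{-1}Y)$ and on $\mathbb{P}V_n$ by $g.[\mu]=[g.\mu]$. Fix the usual hermitian inner product $\langle\cdot,\cdot\rangle$ on $\mathbb{C}^n$; ${}^*$ is the adjoint with respect to it. On $V_n$ use $\langle\mu,\lambda\rangle=\sum_{i,j,k}\langle\mu(X_i,X_j),X_k\rangle\overline{\langle\lambda(X_i,X_j),X_k\rangle}$, $\{X_i\}$ any orthonormal basis of $\mathbb{C}^n$. For $\mu\in V_n$, let $\mathrm{ad}_\mu X(Y)=\mu(X,Y)$ and $$M_\mu=-4\sum_i(\mathrm{ad}_\mu X_i)^*\mathrm{ad}_\mu X_i+2\sum_i\mathrm{ad}_\mu X_i(\mathrm{ad}_\mu X_i)^*.$$ $\mathbb{P}V_n$ is the projective space of $V_n$, $[\mu]$ the class of $\mu\neq0$, and $F_n:\mathbb{P}V_n\to\mathbb{R}$ is $F_n([\mu])=\mathrm{tr}\,M_\mu^2$ for $\|\mu\|=1$.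 $L_n\subset\mathbb{P}V_n$ is the set of $[\mu]$ with $\mu\ne0$ satisfying the Jacobi identity. *)

theory Defs
  imports "HOL-Analysis.Analysis"
begin

text \<open>
  \<open>\<complex>\<^sup>n\<close> is \<open>complex ^ 'n\<close> with \<open>n = CARD('n)\<close>, and complex linearity is linearity with respect to
  \<open>(*s)\<close>. The space \<open>V\<^sub>n\<close> is the set \<open>alt_bilin\<close> of curried maps.
\<close>

type_synonym 'n bracket = "complex ^ 'n \<Rightarrow> complex ^ 'n \<Rightarrow> complex ^ 'n"

definition alt_bilin :: "('n::finite) bracket set" where
  "alt_bilin = {\<mu>. (\<forall>X. Vector_Spaces.linear (*s) (*s) (\<lambda>Y. \<mu> X Y)) \<and>
                    (\<forall>Y. Vector_Spaces.linear (*s) (*s) (\<lambda>X. \<mu> X Y)) \<and>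
                    (\<forall>X. \<mu> X X = 0)}"

definition smult_bracket :: "complex \<Rightarrow> ('n::finite) bracket \<Rightarrow> 'n bracket" where
  "smult_bracket c \<mu> = (\<lambda>X Y. c *s \<mu> X Y)"

definition gl_act :: "complex ^ 'n ^ 'n \<Rightarrow> ('n::finite) bracket \<Rightarrow> 'n bracket" where
  "gl_act g \<mu> = (\<lambda>X Y. g *v \<mu> (matrix_inv g *v X) (matrix_inv g *v Y))"


subsection \<open>Lie brackets and semisimplicity\<close>

definition jacobi :: "('n::finite) bracket \<Rightarrow> bool" where
  "jacobi \<mu> \<longleftrightarrow> (\<forall>X Y Z. \<mu> (\<mu> X Y) Z + \<mu> (\<mu> Y Z) X + \<mu> (\<mu> Z X) Y = 0)"

definition lie_ideal :: "('n::finite) bracket \<Rightarrow> (complex ^ 'n) set \<Rightarrow> bool" where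
  "lie_ideal \<mu> I \<longleftrightarrow> vec.subspace I \<and> (\<forall>X. \<forall>Y\<in>I. \<mu> X Y \<in> I)"

fun derived_series :: "('n::finite) bracket \<Rightarrow> (complex ^ 'n) set \<Rightarrow> nat \<Rightarrow> (complex ^ 'n) set" where
  "derived_series \<mu> I 0 = I"
| "derived_series \<mu> I (Suc k) =
     vec.span {\<mu> X Y | X Y. X \<in> derived_series \<mu> I k \<and> Y \<in> derived_series \<mu> I k}"

definition solvable_part :: "('n::finite) bracket \<Rightarrow> (complex ^ 'n) set \<Rightarrow> bool" where
  "solvable_part \<mu> I \<longleftrightarrow> (\<exists>k. derived_series \<mu> I k = {0})"

text \<open>Semisimple means zero radical, i.e.\ no nonzero solvable ideal.\<close>

definition semisimple_lie :: "('n::finite) bracket \<Rightarrow> bool" where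
  "semisimple_lie \<mu> \<longleftrightarrow> \<mu> \<in> alt_bilin \<and> jacobi \<mu> \<and>
     (\<forall>I. lie_ideal \<mu> I \<and> solvable_part \<mu> I \<longrightarrow> I = {0})"


subsection \<open>Hermitian structure\<close>

definition hinner :: "complex ^ 'n \<Rightarrow> complex ^ ('n::finite) \<Rightarrow> complex" where
  "hinner x y = (\<Sum>i\<in>UNIV. x $ i * cnj (y $ i))"

definition hadjoint :: "complex ^ 'n ^ 'n \<Rightarrow> complex ^ 'n ^ ('n::finite)" where
  "hadjoint A = (\<chi> i j. cnj (A $ j $ i))"

lemma hadjoint_works: "hinner (A *v x) y = hinner x (hadjoint A *v y)"
proof -
  have "hinner (A *v x) y = (\<Sum>i\<in>UNIV. \<Sum>j\<in>UNIV. A $ i $ j * x $ j * cnj (y $ i))"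
    by (simp add: hinner_def matrix_vector_mult_def sum_distrib_right)
  also have "\<dots> = (\<Sum>j\<in>UNIV. \<Sum>i\<in>UNIV. A $ i $ j * x $ j * cnj (y $ i))"
    by (rule sum.swap)
  also have "\<dots> = hinner x (hadjoint A *v y)"
    by (simp add: hinner_def matrix_vector_mult_def hadjoint_def sum_distrib_left mult_ac)
  finally show ?thesis .
qed

text \<open>
  The sums over an orthonormal basis are written out for the standard basis \<open>axis i 1\<close>; lemmas
  \<open>bracket_inner_orthonormal\<close> and \<open>M_op_orthonormal\<close> below show that any other orthonormal basis
  gives the same values.
\<close>

definition bracket_inner :: "('n::finite) bracket \<Rightarrow> 'n bracket \<Rightarrow> complex" where
  "bracket_inner \<mu> \<nu> = (\<Sum>i\<in>UNIV. \<Sum>j\<in>UNIV. \<Sum>k\<in>UNIV.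
     hinner (\<mu> (axis i 1) (axis j 1)) (axis k 1) *
     cnj (hinner (\<nu> (axis i 1) (axis j 1)) (axis k 1)))"

definition bracket_norm :: "('n::finite) bracket \<Rightarrow> real" where
  "bracket_norm \<mu> = sqrt (Re (bracket_inner \<mu> \<mu>))"

definition ad :: "('n::finite) bracket \<Rightarrow> complex ^ 'n \<Rightarrow> complex ^ 'n ^ 'n" where
  "ad \<mu> X = matrix (\<lambda>Y. \<mu> X Y)"

definition M_op :: "('n::finite) bracket \<Rightarrow> complex ^ 'n ^ 'n" where
  "M_op \<mu> =
     (- 4) *\<^sub>R (\<Sum>i\<in>UNIV. hadjoint (ad \<mu> (axis i 1)) ** ad \<mu> (axis i 1)) +
     2 *\<^sub>R (\<Sum>i\<in>UNIV. ad \<mu> (axis i 1) ** hadjoint (ad \<mu> (axis i 1)))"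


subsection \<open>Projective space\<close>

text \<open>
  A point of \<open>\<P>V\<^sub>n\<close> is the set of nonzero multiples of a nonzero element of \<open>V\<^sub>n\<close>.
\<close>

definition proj_class :: "('n::finite) bracket \<Rightarrow> 'n bracket set" where
  "proj_class \<mu> = {smult_bracket c \<mu> | c. c \<noteq> 0}"

definition proj_space :: "('n::finite) bracket set set" where
  "proj_space = {proj_class \<mu> | \<mu>. \<mu> \<in> alt_bilin \<and> \<mu> \<noteq> (\<lambda>X Y. 0)}"

definition lie_variety :: "('n::finite) bracket set set" where
  "lie_variety = {proj_class \<mu> | \<mu>. \<mu> \<in> alt_bilin \<and> \<mu> \<noteq> (\<lambda>X Y. 0) \<and> jacobi \<mu>}"

definition proj_act :: "complex ^ 'n ^ 'n \<Rightarrow> ('n::finite) bracket set \<Rightarrow> 'n bracket set" where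
  "proj_act g P = gl_act g ` P"

definition gl_orbit :: "('n::finite) bracket set \<Rightarrow> 'n bracket set set" where
  "gl_orbit P = {proj_act g P | g. invertible g}"

text \<open>
  \<open>F_fun\<close> is meaningful on \<open>proj_space\<close> only; lemma \<open>F_fun_eq\<close> below shows that it is well defined
  there.
\<close>

definition F_fun :: "('n::finite) bracket set \<Rightarrow> real" where
  "F_fun P = (THE r. \<exists>\<mu>\<in>P. bracket_norm \<mu> = 1 \<and>
                      complex_of_real r = trace (M_op \<mu> ** M_op \<mu>))"


subsection \<open>Consistency of the definitions\<close>

lemma proj_act_proj_class: "proj_act g (proj_class \<mu>) = proj_class (gl_act g \<mu>)"
proof -
  have "gl_act g (smult_bracket c \<mu>) = smult_bracket c (gl_act g \<mu>)" for c
    by (simp add: gl_act_def smult_bracket_def vec.scale)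
  then show ?thesis
    by (auto simp: proj_act_def proj_class_def image_iff) metis
qed

lemma ad_nth: "ad \<mu> X $ a $ b = \<mu> X (axis b 1) $ a"
  by (simp add: ad_def matrix_def)

lemma M_op_nth:
  "M_op \<mu> $ a $ b =
     - 4 * (\<Sum>i\<in>UNIV. \<Sum>k\<in>UNIV. cnj (ad \<mu> (axis i 1) $ k $ a) * ad \<mu> (axis i 1) $ k $ b) +
     2 * (\<Sum>i\<in>UNIV. \<Sum>k\<in>UNIV. ad \<mu> (axis i 1) $ a $ k * cnj (ad \<mu> (axis i 1) $ b $ k))"
  unfolding M_op_def
  by (simp add: matrix_matrix_mult_def hadjoint_def) (simp add: scaleR_conv_of_real)

lemma M_op_hermitian: "hadjoint (M_op \<mu>) = M_op \<mu>"
  by (simp add: vec_eq_iff hadjoint_def M_op_nth mult.commute)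

lemma trace_M_op_sq_real: "Im (trace (M_op \<mu> ** M_op \<mu>)) = 0"
proof -
  have *: "M_op \<mu> $ b $ a = cnj (M_op \<mu> $ a $ b)" for a b
    using M_op_hermitian[of \<mu>] by (simp add: vec_eq_iff hadjoint_def)
  have "trace (M_op \<mu> ** M_op \<mu>) = (\<Sum>a\<in>UNIV. \<Sum>b\<in>UNIV. M_op \<mu> $ a $ b * cnj (M_op \<mu> $ a $ b))"
    by (simp add: trace_def matrix_matrix_mult_def *[symmetric])
  then show ?thesis
    by simp
qed

lemma bracket_norm_smult: "bracket_norm (smult_bracket c \<mu>) = cmod c * bracket_norm \<mu>"
proof -
  have h: "hinner (c *s x) y = c * hinner x y" for x y :: "complex ^ 'n"
    by (simp add: hinner_def sum_distrib_left mult_ac)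
  have "bracket_inner (smult_bracket c \<mu>) (smult_bracket c \<mu>) = (c * cnj c) * bracket_inner \<mu> \<mu>"
    by (simp add: bracket_inner_def smult_bracket_def h sum_distrib_left mult_ac)
  then show ?thesis
    by (simp add: bracket_norm_def complex_mult_cnj real_sqrt_mult cmod_def)
qed

lemma M_op_smult_unit:
  assumes "cmod c = 1"
  shows "M_op (smult_bracket c \<mu>) = M_op \<mu>"
proof -
  have "c * cnj c = 1"
    using complex_norm_square[of c] assms by simp
  then have 1: "cnj (c * x) * (c * y) = cnj x * y" and 2: "(c * y) * cnj (c * x) = y * cnj x" for x y
    by (simp_all add: mult_ac)
  have "ad (smult_bracket c \<mu>) X $ a $ b = c * ad \<mu> X $ a $ b" for X a b
    by (simp add: ad_nth smult_bracket_def)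
  then show ?thesis
    by (simp only: vec_eq_iff M_op_nth 1 2) simp
qed

lemma F_fun_eq:
  assumes "bracket_norm \<mu> = 1"
  shows "complex_of_real (F_fun (proj_class \<mu>)) = trace (M_op \<mu> ** M_op \<mu>)"
proof -
  have mem: "\<mu> \<in> proj_class \<mu>"
    unfolding proj_class_def by (auto simp: smult_bracket_def intro!: exI[of _ 1])
  have tr: "complex_of_real (Re (trace (M_op \<mu> ** M_op \<mu>))) = trace (M_op \<mu> ** M_op \<mu>)"
    by (simp add: complex_eq_iff trace_M_op_sq_real)
  have uniq: "M_op \<nu> = M_op \<mu>" if "\<nu> \<in> proj_class \<mu>" "bracket_norm \<nu> = 1" for \<nu>
    using that assms by (auto simp: proj_class_def bracket_norm_smult M_op_smult_unit)
  have "F_fun (proj_class \<mu>) = Re (trace (M_op \<mu> ** M_op \<mu>))"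
    unfolding F_fun_def
  proof (rule the_equality)
    show "\<exists>\<nu>\<in>proj_class \<mu>. bracket_norm \<nu> = 1 \<and>
            complex_of_real (Re (trace (M_op \<mu> ** M_op \<mu>))) = trace (M_op \<nu> ** M_op \<nu>)"
      using mem assms tr by blast
  next
    fix r
    assume "\<exists>\<nu>\<in>proj_class \<mu>. bracket_norm \<nu> = 1 \<and> complex_of_real r = trace (M_op \<nu> ** M_op \<nu>)"
    then show "r = Re (trace (M_op \<mu> ** M_op \<mu>))"
      using uniq by (metis Re_complex_of_real)
  qed
  with tr show ?thesis by simp
qed

lemma linear_nth_expand:
  fixes f :: "complex ^ 'n \<Rightarrow> complex ^ ('n::finite)"
  assumes "Vector_Spaces.linear (*s) (*s) f"
  shows "f x $ k = (\<Sum>j\<in>UNIV. x $ j * f (axis j 1) $ k)"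
proof -
  have "f x $ k = (matrix f *v x) $ k"
    by (simp add: matrix_works[OF assms])
  then show ?thesis
    by (simp add: matrix_vector_mult_def matrix_def mult.commute)
qed

lemma bracket_norm_pos:
  assumes "\<mu> \<in> alt_bilin" "\<mu> \<noteq> (\<lambda>X Y. 0)"
  shows "bracket_norm \<mu> > 0"
proof -
  let ?c = "\<lambda>i j k. \<mu> (axis i 1) (axis j 1) $ k"
  have l: "Vector_Spaces.linear (*s) (*s) (\<mu> X)" "Vector_Spaces.linear (*s) (*s) (\<lambda>X. \<mu> X Y)" for X Y
    using assms(1) by (auto simp: alt_bilin_def)
  have h: "hinner v (axis k 1) = v $ k" for v :: "complex ^ 'n" and k
    by (simp add: hinner_def axis_def if_distrib cong: if_cong)
  have re: "Re (bracket_inner \<mu> \<mu>) = (\<Sum>i\<in>UNIV. \<Sum>j\<in>UNIV. \<Sum>k\<in>UNIV. (cmod (?c i j k))\<^sup>2)"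
    by (simp add: bracket_inner_def h cmod_power2 flip: power2_eq_square)
  have "Re (bracket_inner \<mu> \<mu>) \<noteq> 0"
  proof
    assume "Re (bracket_inner \<mu> \<mu>) = 0"
    then have z: "?c i j k = 0" for i j k
      unfolding re by (simp add: sum_nonneg_eq_0_iff sum_nonneg)
    have "\<mu> X Y $ k = 0" for X Y k
      by (subst linear_nth_expand[OF l(1)], subst linear_nth_expand[OF l(2)]) (simp add: z)
    with assms(2) show False
      by (simp add: fun_eq_iff vec_eq_iff)
  qed
  moreover have "Re (bracket_inner \<mu> \<mu>) \<ge> 0"
    unfolding re by (intro sum_nonneg) simp
  ultimately show ?thesis
    by (simp add: bracket_norm_def)
qed

lemma proj_space_unit_rep:
  assumes "P \<in> proj_space"
  obtains \<mu> where "\<mu> \<in> alt_bilin" "bracket_norm \<mu> = 1" "P = proj_class \<mu>"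
proof -
  obtain \<nu> where \<nu>: "\<nu> \<in> alt_bilin" "\<nu> \<noteq> (\<lambda>X Y. 0)" "P = proj_class \<nu>"
    using assms by (auto simp: proj_space_def)
  define c where "c = complex_of_real (1 / bracket_norm \<nu>)"
  have pos: "bracket_norm \<nu> > 0"
    by (rule bracket_norm_pos[OF \<nu>(1,2)])
  then have c: "c \<noteq> 0" by (simp add: c_def)
  have 1: "smult_bracket c \<nu> \<in> alt_bilin"
    using \<nu>(1) by (auto simp: alt_bilin_def smult_bracket_def vec.linear_compose_scale_right)
  have 2: "bracket_norm (smult_bracket c \<nu>) = 1"
    using pos by (simp add: bracket_norm_smult c_def norm_divide)
  have s: "smult_bracket d (smult_bracket c \<nu>) = smult_bracket (d * c) \<nu>" for d
    by (simp add: smult_bracket_def)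
  have "proj_class \<nu> = proj_class (smult_bracket c \<nu>)"
  proof (rule set_eqI, rule iffI)
    fix x assume "x \<in> proj_class \<nu>"
    then obtain d where "d \<noteq> 0" "x = smult_bracket d \<nu>" by (auto simp: proj_class_def)
    then have "d / c \<noteq> 0" "x = smult_bracket (d / c) (smult_bracket c \<nu>)"
      using c by (simp_all add: s)
    then show "x \<in> proj_class (smult_bracket c \<nu>)" unfolding proj_class_def by blast
  next
    fix x assume "x \<in> proj_class (smult_bracket c \<nu>)"
    then obtain d where "d \<noteq> 0" "x = smult_bracket (d * c) \<nu>" by (auto simp: proj_class_def s)
    then show "x \<in> proj_class \<nu>" using c unfolding proj_class_def by auto
  qed
  with 1 2 \<nu>(3) that show thesis by blast
qed

lemma orthonormal_sum:
  fixes X :: "'n::finite \<Rightarrow> complex ^ 'n"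
  assumes "\<And>i j. hinner (X i) (X j) = (if i = j then 1 else 0)"
  shows "(\<Sum>i\<in>UNIV. (\<Sum>j\<in>UNIV. X i $ j * p j) * cnj (\<Sum>j\<in>UNIV. X i $ j * q j)) =
         (\<Sum>j\<in>UNIV. p j * cnj (q j))"
proof -
  define U where "U = (\<chi> i j. X i $ j)"
  have "U ** hadjoint U = mat 1"
    using assms by (simp add: vec_eq_iff U_def matrix_matrix_mult_def hadjoint_def mat_def hinner_def)
  then have "hadjoint U ** U = mat 1"
    by (simp add: matrix_left_right_inverse)
  then have d: "(\<Sum>i\<in>UNIV. cnj (X i $ l) * X i $ j) = (if l = j then 1 else 0)" for l j
    by (simp add: vec_eq_iff U_def matrix_matrix_mult_def hadjoint_def mat_def)
  have "(\<Sum>i\<in>UNIV. (\<Sum>j\<in>UNIV. X i $ j * p j) * cnj (\<Sum>l\<in>UNIV. X i $ l * q l)) =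
        (\<Sum>i\<in>UNIV. \<Sum>j\<in>UNIV. \<Sum>l\<in>UNIV. p j * cnj (q l) * (cnj (X i $ l) * X i $ j))"
    by (simp add: sum_product mult_ac)
  also have "\<dots> = (\<Sum>j\<in>UNIV. \<Sum>i\<in>UNIV. \<Sum>l\<in>UNIV. p j * cnj (q l) * (cnj (X i $ l) * X i $ j))"
    by (rule sum.swap)
  also have "\<dots> = (\<Sum>j\<in>UNIV. \<Sum>l\<in>UNIV. \<Sum>i\<in>UNIV. p j * cnj (q l) * (cnj (X i $ l) * X i $ j))"
    by (intro sum.cong refl sum.swap)
  also have "\<dots> = (\<Sum>j\<in>UNIV. \<Sum>l\<in>UNIV. p j * cnj (q l) * (if l = j then 1 else 0))"
    by (simp only: sum_distrib_left[symmetric] d)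
  also have "\<dots> = (\<Sum>j\<in>UNIV. p j * cnj (q j))"
    by (simp add: if_distrib cong: if_cong)
  finally show ?thesis .
qed

lemma orthonormal_sum_linear:
  fixes X :: "'n::finite \<Rightarrow> complex ^ 'n" and f g :: "complex ^ 'n \<Rightarrow> complex ^ 'n"
  assumes "\<And>i j. hinner (X i) (X j) = (if i = j then 1 else 0)"
    and "Vector_Spaces.linear (*s) (*s) f" "Vector_Spaces.linear (*s) (*s) g"
  shows "(\<Sum>i\<in>UNIV. f (X i) $ a * cnj (g (X i) $ b)) =
         (\<Sum>i\<in>UNIV. f (axis i 1) $ a * cnj (g (axis i 1) $ b))"
  using orthonormal_sum[OF assms(1), of "\<lambda>j. f (axis j 1) $ a" "\<lambda>j. g (axis j 1) $ b"]
  by (simp flip: linear_nth_expand[OF assms(2)] linear_nth_expand[OF assms(3)])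

lemma M_op_orthonormal:
  fixes X :: "'n::finite \<Rightarrow> complex ^ 'n"
  assumes X: "\<And>i j. hinner (X i) (X j) = (if i = j then 1 else 0)" and \<mu>: "\<mu> \<in> alt_bilin"
  shows "M_op \<mu> = (- 4) *\<^sub>R (\<Sum>i\<in>UNIV. hadjoint (ad \<mu> (X i)) ** ad \<mu> (X i)) +
                  2 *\<^sub>R (\<Sum>i\<in>UNIV. ad \<mu> (X i) ** hadjoint (ad \<mu> (X i)))"
proof -
  have l: "Vector_Spaces.linear (*s) (*s) (\<lambda>X. \<mu> X Y)" for Y
    using \<mu> by (auto simp: alt_bilin_def)
  have e: "(\<Sum>i\<in>UNIV. ad \<mu> (X i) $ a $ b * cnj (ad \<mu> (X i) $ c $ d)) =
           (\<Sum>i\<in>UNIV. ad \<mu> (axis i 1) $ a $ b * cnj (ad \<mu> (axis i 1) $ c $ d))" for a b c d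
    unfolding ad_nth by (rule orthonormal_sum_linear[OF X l l])
  have 1: "(\<Sum>i\<in>UNIV. hadjoint (ad \<mu> (X i)) ** ad \<mu> (X i)) =
           (\<Sum>i\<in>UNIV. hadjoint (ad \<mu> (axis i 1)) ** ad \<mu> (axis i 1))"
    by (simp add: vec_eq_iff matrix_matrix_mult_def hadjoint_def mult.commute[of "cnj _"])
       (subst (1 2) sum.swap, simp add: e)
  have 2: "(\<Sum>i\<in>UNIV. ad \<mu> (X i) ** hadjoint (ad \<mu> (X i))) =
           (\<Sum>i\<in>UNIV. ad \<mu> (axis i 1) ** hadjoint (ad \<mu> (axis i 1)))"
    by (simp add: vec_eq_iff matrix_matrix_mult_def hadjoint_def)
       (subst (1 2) sum.swap, simp add: e)
  show ?thesis unfolding M_op_def 1 2 ..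
qed

lemma bracket_inner_orthonormal:
  fixes X :: "'n::finite \<Rightarrow> complex ^ 'n"
  assumes X: "\<And>i j. hinner (X i) (X j) = (if i = j then 1 else 0)"
    and \<mu>: "\<mu> \<in> alt_bilin" and \<nu>: "\<nu> \<in> alt_bilin"
  shows "bracket_inner \<mu> \<nu> = (\<Sum>i\<in>UNIV. \<Sum>j\<in>UNIV. \<Sum>k\<in>UNIV.
     hinner (\<mu> (X i) (X j)) (X k) * cnj (hinner (\<nu> (X i) (X j)) (X k)))"
proof -
  have l: "Vector_Spaces.linear (*s) (*s) (\<mu> Y)" "Vector_Spaces.linear (*s) (*s) (\<lambda>X. \<mu> X Y)"
          "Vector_Spaces.linear (*s) (*s) (\<nu> Y)" "Vector_Spaces.linear (*s) (*s) (\<lambda>X. \<nu> X Y)" for Y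
    using \<mu> \<nu> by (auto simp: alt_bilin_def)
  have p: "(\<Sum>k\<in>UNIV. hinner v (X k) * cnj (hinner w (X k))) = hinner v w" for v w
    using orthonormal_sum[OF X, of "\<lambda>j. cnj (w $ j)" "\<lambda>j. cnj (v $ j)"]
    by (simp add: hinner_def mult.commute)
  have h: "hinner v (axis k 1) = v $ k" for v :: "complex ^ 'n" and k
    by (simp add: hinner_def axis_def if_distrib cong: if_cong)
  have "(\<Sum>i\<in>UNIV. \<Sum>j\<in>UNIV. \<Sum>k\<in>UNIV.
           hinner (\<mu> (X i) (X j)) (X k) * cnj (hinner (\<nu> (X i) (X j)) (X k))) =
        (\<Sum>i\<in>UNIV. \<Sum>j\<in>UNIV. \<Sum>k\<in>UNIV. \<mu> (X i) (X j) $ k * cnj (\<nu> (X i) (X j) $ k))"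
    unfolding p by (simp add: hinner_def)
  also have "\<dots> = (\<Sum>i\<in>UNIV. \<Sum>k\<in>UNIV. \<Sum>j\<in>UNIV. \<mu> (X i) (X j) $ k * cnj (\<nu> (X i) (X j) $ k))"
    by (intro sum.cong refl sum.swap)
  also have "\<dots> = (\<Sum>i\<in>UNIV. \<Sum>k\<in>UNIV. \<Sum>j\<in>UNIV.
                    \<mu> (X i) (axis j 1) $ k * cnj (\<nu> (X i) (axis j 1) $ k))"
    by (intro sum.cong refl orthonormal_sum_linear[OF X l(1) l(3)])
  also have "\<dots> = (\<Sum>k\<in>UNIV. \<Sum>i\<in>UNIV. \<Sum>j\<in>UNIV.
                    \<mu> (X i) (axis j 1) $ k * cnj (\<nu> (X i) (axis j 1) $ k))"
    by (rule sum.swap)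
  also have "\<dots> = (\<Sum>k\<in>UNIV. \<Sum>j\<in>UNIV. \<Sum>i\<in>UNIV.
                    \<mu> (X i) (axis j 1) $ k * cnj (\<nu> (X i) (axis j 1) $ k))"
    by (intro sum.cong refl sum.swap)
  also have "\<dots> = (\<Sum>k\<in>UNIV. \<Sum>j\<in>UNIV. \<Sum>i\<in>UNIV.
                    \<mu> (axis i 1) (axis j 1) $ k * cnj (\<nu> (axis i 1) (axis j 1) $ k))"
    by (intro sum.cong refl orthonormal_sum_linear[OF X l(2) l(4)])
  also have "\<dots> = (\<Sum>k\<in>UNIV. \<Sum>i\<in>UNIV. \<Sum>j\<in>UNIV.
                    \<mu> (axis i 1) (axis j 1) $ k * cnj (\<nu> (axis i 1) (axis j 1) $ k))"
    by (intro sum.cong refl sum.swap)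
  also have "\<dots> = (\<Sum>i\<in>UNIV. \<Sum>k\<in>UNIV. \<Sum>j\<in>UNIV.
                    \<mu> (axis i 1) (axis j 1) $ k * cnj (\<nu> (axis i 1) (axis j 1) $ k))"
    by (rule sum.swap)
  also have "\<dots> = (\<Sum>i\<in>UNIV. \<Sum>j\<in>UNIV. \<Sum>k\<in>UNIV.
                    \<mu> (axis i 1) (axis j 1) $ k * cnj (\<nu> (axis i 1) (axis j 1) $ k))"
    by (intro sum.cong refl sum.swap)
  also have "\<dots> = bracket_inner \<mu> \<nu>"
    by (simp add: bracket_inner_def h)
  finally show ?thesis by simp
qed

end

theory Submission
  imports Defs
begin

text \<open>
  The trace of \<open>M\<^sub>\<mu>\<close> is \<open>-2 \<parallel>\<mu>\<parallel>\<^sup>2\<close>, so Cauchy--Schwarz gives \<open>F\<^sub>n \<ge> 4/n\<close>, with equality exactly when \<open>M\<^sub>\<mu>\<close>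
  is a scalar matrix \<open>c I\<close>, and then \<open>c < 0\<close>.

  If \<open>M\<^sub>\<mu> = c I\<close>, then for a derivation \<open>D\<close> the moment map identity yields
  \<open>2 \<parallel>D\<^sup>*.\<mu>\<parallel>\<^sup>2 = tr ([D, D\<^sup>*] M\<^sub>\<mu>) = 0\<close>, so the derivations are closed under adjoints. As the centre is
  trivial, the inner derivations are closed under adjoints as well, which excludes abelian ideals.

  Conversely, for semisimple \<open>\<mu>\<close> put \<open>\<lambda>\<^sub>T = T\<^sup>-\<^sup>1.\<mu>\<close> and minimise \<open>\<parallel>\<lambda>\<^sub>T\<parallel>\<^sup>2 + \<epsilon> \<parallel>T\<parallel>\<^sup>2\<close> over
  \<open>\<bar>det T\<bar> = 1\<close>. A minimiser satisfies \<open>M - 2 \<epsilon> T\<^sup>*T = c I\<close> for \<open>M\<close> the moment matrix of \<open>\<lambda>\<^sub>T\<close>. If the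
  minimisers stay bounded as \<open>\<epsilon> \<rightarrow> 0\<close>, a limit point makes the moment matrix scalar. Otherwise a limit
  \<open>U\<close> of the normalised minimisers \<open>T / \<parallel>T\<parallel>\<close> has range a nonzero abelian ideal of \<open>\<mu>\<close>:
  \<open>\<mu>(UX, UY) = 0\<close> because \<open>\<lambda>\<^sub>T\<close> is bounded, and the range is invariant under every derivation \<open>D\<close>
  because \<open>D' = T\<^sup>-\<^sup>1 D T\<close> satisfies \<open>\<parallel>D' T\<^sup>*\<parallel> \<le> \<parallel>T D'\<parallel> = \<parallel>D T\<parallel>\<close>, so that \<open>D T T\<^sup>* = T (D' T\<^sup>*)\<close> survives the
  limit as \<open>D U U\<^sup>* = U E\<close>. This contradicts semisimplicity.
\<close>

subsection \<open>Complex matrices as a real inner product space\<close>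

text \<open>The real inner product under the hermitian one supplies norms, limits and orthogonal
  projections, while adjoints still move across it.\<close>

lemma inner_eq_Re_hinner: "inner x y = Re (hinner x y)"
  by (simp add: inner_vec_def hinner_def inner_complex_def)

lemma hadjoint_hadjoint [simp]: "hadjoint (hadjoint A) = A"
  by (simp add: hadjoint_def vec_eq_iff)

lemma hadjoint_mult: "hadjoint (A ** B) = hadjoint B ** hadjoint A"
  by (simp add: hadjoint_def vec_eq_iff matrix_matrix_mult_def mult.commute)

lemma hadjoint_diff: "hadjoint (A - B) = hadjoint A - hadjoint B"
  by (simp add: hadjoint_def vec_eq_iff)

lemma hadjoint_scaleR: "hadjoint (r *\<^sub>R A) = r *\<^sub>R hadjoint A"
  by (simp add: hadjoint_def vec_eq_iff)

lemma inner_mult_vec_left: "inner (A *v x) y = inner x (hadjoint A *v y)"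
  by (simp add: inner_eq_Re_hinner hadjoint_works)

lemma inner_mult_vec_right: "inner x (A *v y) = inner (hadjoint A *v x) y"
  by (simp add: inner_mult_vec_left)

lemma inner_matrix_columns:
  fixes A B :: "complex ^ 'n ^ ('n::finite)"
  shows "inner A B = (\<Sum>j\<in>UNIV. inner (A *v axis j 1) (B *v axis j 1))"
proof -
  have "(C *v axis j 1) $ i = C $ i $ j" for C :: "complex ^ 'n ^ 'n" and i j
    by (simp add: matrix_vector_mult_def axis_def if_distrib cong: if_cong)
  then show ?thesis
    by (simp add: inner_vec_def) (rule sum.swap)
qed

lemma inner_matrix_mult_left:
  fixes A B C :: "complex ^ 'n ^ ('n::finite)"
  shows "inner (A ** B) C = inner B (hadjoint A ** C)"
  unfolding inner_matrix_columns matrix_vector_mul_assoc[symmetric] inner_mult_vec_left ..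

lemma inner_hadjoint:
  fixes A B :: "complex ^ 'n ^ ('n::finite)"
  shows "inner (hadjoint A) (hadjoint B) = inner A B"
  by (simp add: inner_vec_def hadjoint_def inner_complex_def) (rule sum.swap)

lemma inner_matrix_mult_right:
  fixes A B C :: "complex ^ 'n ^ ('n::finite)"
  shows "inner (A ** B) C = inner A (C ** hadjoint B)"
proof -
  have "inner (A ** B) C = inner (hadjoint B ** hadjoint A) (hadjoint C)"
    by (simp only: inner_hadjoint flip: hadjoint_mult)
  also have "\<dots> = inner (hadjoint A) (hadjoint (C ** hadjoint B))"
    by (simp only: inner_matrix_mult_left hadjoint_mult hadjoint_hadjoint)
  finally show ?thesis
    by (simp only: inner_hadjoint)
qed

lemma inner_mat_1_right: "inner A (mat 1) = Re (trace (A :: complex ^ 'n ^ ('n::finite)))"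
  by (simp add: inner_vec_def mat_def trace_def inner_complex_def if_distrib cong: if_cong)

lemma trace_commute: "trace (A ** B) = trace (B ** (A :: complex ^ 'n ^ ('n::finite)))"
  by (simp add: trace_def matrix_matrix_mult_def mult.commute) (rule sum.swap)

lemma inner_self_mat_1: "inner (mat 1) (mat 1 :: complex ^ 'n ^ ('n::finite)) = CARD('n)"
  by (simp only: inner_mat_1_right) (simp add: trace_def mat_def)

lemma matrix_add_rdistrib: "(A + B) ** C = A ** C + B ** (C :: complex ^ 'n ^ ('n::finite))"
  by (simp add: matrix_matrix_mult_def vec_eq_iff sum.distrib distrib_right)

lemma matrix_diff_rdistrib: "(A - B) ** C = A ** C - B ** (C :: complex ^ 'n ^ ('n::finite))"
  by (simp add: matrix_matrix_mult_def vec_eq_iff sum_subtractf left_diff_distrib)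

lemma matrix_diff_ldistrib: "C ** (A - B) = C ** A - C ** (B :: complex ^ 'n ^ ('n::finite))"
  by (simp add: matrix_matrix_mult_def vec_eq_iff sum_subtractf right_diff_distrib)

lemma scaleR_matrix_vector:
  "(r *\<^sub>R A) *v x = r *\<^sub>R (A *v (x :: complex ^ ('n::finite)))"
  by (simp add: vec_eq_iff matrix_vector_mult_def scaleR_sum_right)

lemma matrix_vector_scaleR:
  "A *v (r *\<^sub>R x) = r *\<^sub>R (A *v (x :: complex ^ ('n::finite)))"
  by (simp add: vec_eq_iff matrix_vector_mult_def scaleR_sum_right)

lemma scaleR_eq_smult: "r *\<^sub>R x = complex_of_real r *s (x :: complex ^ ('n::finite))"
  by (simp only: vec_eq_iff vector_scaleR_component vector_smult_component)
    (simp add: scaleR_conv_of_real)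

lemma matrix_inv_unique:
  fixes A B :: "complex ^ 'n ^ ('n::finite)"
  assumes "A ** B = mat 1"
  shows "matrix_inv A = B"
proof -
  have BA: "B ** A = mat 1"
    using assms matrix_left_right_inverse by blast
  have "A ** matrix_inv A = mat 1 \<and> matrix_inv A ** A = mat 1"
    unfolding matrix_inv_def by (rule someI[of _ B]) (use assms BA in blast)
  then show ?thesis
    by (metis BA matrix_mul_assoc matrix_mul_lid matrix_mul_rid)
qed

lemma matrix_inv_mult:
  fixes A :: "complex ^ 'n ^ ('n::finite)"
  assumes "invertible A"
  shows "A ** matrix_inv A = mat 1" "matrix_inv A ** A = mat 1"
proof -
  obtain B where "A ** B = mat 1"
    using assms by (auto simp: invertible_def)
  with matrix_inv_unique[OF this] show "A ** matrix_inv A = mat 1"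
    by simp
  then show "matrix_inv A ** A = mat 1"
    using matrix_left_right_inverse by blast
qed

lemma invertible_matrix_inv:
  fixes A :: "complex ^ 'n ^ ('n::finite)"
  assumes "invertible A"
  shows "invertible (matrix_inv A)" "matrix_inv (matrix_inv A) = A"
  using matrix_inv_mult[OF assms] by (auto simp: invertible_def intro: matrix_inv_unique)

lemma matrix_inv_vec:
  fixes A :: "complex ^ 'n ^ ('n::finite)"
  assumes "invertible A"
  shows "A *v (matrix_inv A *v x) = x" "matrix_inv A *v (A *v x) = x"
  by (simp_all add: matrix_vector_mul_assoc matrix_inv_mult[OF assms])


subsection \<open>Brackets and the infinitesimal action\<close>

lemma bracket_linear:
  assumes "\<mu> \<in> alt_bilin"
  shows bracket_add_right: "\<mu> X (Y + Z) = \<mu> X Y + \<mu> X Z"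
    and bracket_add_left: "\<mu> (X + Y) Z = \<mu> X Z + \<mu> Y Z"
    and bracket_diff_right: "\<mu> X (Y - Z) = \<mu> X Y - \<mu> X Z"
    and bracket_diff_left: "\<mu> (X - Y) Z = \<mu> X Z - \<mu> Y Z"
    and bracket_scale_right: "\<mu> X (c *s Y) = c *s \<mu> X Y"
    and bracket_scale_left: "\<mu> (c *s X) Y = c *s \<mu> X Y"
    and bracket_scaleR_right: "\<mu> X (r *\<^sub>R Y) = r *\<^sub>R \<mu> X Y"
    and bracket_scaleR_left: "\<mu> (r *\<^sub>R X) Y = r *\<^sub>R \<mu> X Y"
    and bracket_zero_right: "\<mu> X 0 = 0"
    and bracket_zero_left: "\<mu> 0 X = 0"
    and bracket_sum_right: "\<mu> X (\<Sum>i\<in>I. f i) = (\<Sum>i\<in>I. \<mu> X (f i))"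
    and bracket_sum_left: "\<mu> (\<Sum>i\<in>I. f i) X = (\<Sum>i\<in>I. \<mu> (f i) X)"
proof -
  have r: "Vector_Spaces.linear (*s) (*s) (\<mu> X)"
    and l: "Vector_Spaces.linear (*s) (*s) (\<lambda>X. \<mu> X Y)" for X Y
    using assms by (auto simp: alt_bilin_def)
  interpret r: Vector_Spaces.linear "(*s)" "(*s)" "\<mu> X" for X by (rule r)
  interpret l: Vector_Spaces.linear "(*s)" "(*s)" "\<lambda>X. \<mu> X Y" for Y by (rule l)
  show "\<mu> X (Y + Z) = \<mu> X Y + \<mu> X Z" by (rule r.add)
  show "\<mu> (X + Y) Z = \<mu> X Z + \<mu> Y Z" by (rule l.add)
  show "\<mu> X (Y - Z) = \<mu> X Y - \<mu> X Z" by (rule r.diff)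
  show "\<mu> (X - Y) Z = \<mu> X Z - \<mu> Y Z" by (rule l.diff)
  show sr: "\<mu> X (c *s Y) = c *s \<mu> X Y" for c by (rule r.scale)
  show sl: "\<mu> (c *s X) Y = c *s \<mu> X Y" for c by (rule l.scale)
  show "\<mu> X (r *\<^sub>R Y) = r *\<^sub>R \<mu> X Y" by (simp add: scaleR_eq_smult sr)
  show "\<mu> (r *\<^sub>R X) Y = r *\<^sub>R \<mu> X Y" by (simp add: scaleR_eq_smult sl)
  show "\<mu> X 0 = 0" by (rule r.zero)
  show "\<mu> 0 X = 0" by (rule l.zero)
  show "\<mu> X (\<Sum>i\<in>I. f i) = (\<Sum>i\<in>I. \<mu> X (f i))" by (rule r.sum)
  show "\<mu> (\<Sum>i\<in>I. f i) X = (\<Sum>i\<in>I. \<mu> (f i) X)" by (rule l.sum)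
qed

lemma bracket_skew:
  assumes "\<mu> \<in> alt_bilin"
  shows "\<mu> Y X = - \<mu> X Y"
proof -
  have "\<mu> (X + Y) (X + Y) = 0" "\<mu> X X = 0" "\<mu> Y Y = 0"
    using assms by (simp_all add: alt_bilin_def)
  then show ?thesis
    by (simp add: bracket_add_right[OF assms] bracket_add_left[OF assms] add_eq_0_iff2)
qed

lemma alt_bilinI:
  assumes "\<And>X Y Z. \<mu> X (Y + Z) = \<mu> X Y + \<mu> X Z" "\<And>X Y Z. \<mu> (X + Y) Z = \<mu> X Z + \<mu> Y Z"
    "\<And>c X Y. \<mu> X (c *s Y) = c *s \<mu> X Y" "\<And>c X Y. \<mu> (c *s X) Y = c *s \<mu> X Y"
    "\<And>X. \<mu> X X = 0"
  shows "\<mu> \<in> alt_bilin"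
  using assms
  by (auto simp: alt_bilin_def Vector_Spaces.linear_iff vec.vector_space_axioms)

lemma mult_axis_expand: "A *v axis i 1 = (\<Sum>l\<in>UNIV. A $ l $ i *s axis l (1::complex))"
  by (simp add: vec_eq_iff matrix_vector_mult_def axis_def if_distrib cong: if_cong)

lemma bracket_expand:
  assumes "\<mu> \<in> alt_bilin"
  shows "\<mu> X Y = (\<Sum>i\<in>UNIV. \<Sum>j\<in>UNIV. (X $ i * Y $ j) *s \<mu> (axis i 1) (axis j 1))"
proof -
  have e: "Z = (\<Sum>l\<in>UNIV. Z $ l *s axis l (1::complex))" for Z :: "complex ^ 'a"
    by (simp add: vec_eq_iff axis_def if_distrib cong: if_cong)
  have "\<mu> X Y = \<mu> (\<Sum>i\<in>UNIV. X $ i *s axis i 1) Y"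
    using e[of X] by simp
  also have "\<dots> = (\<Sum>i\<in>UNIV. X $ i *s \<mu> (axis i 1) (\<Sum>j\<in>UNIV. Y $ j *s axis j 1))"
    using e[of Y] by (simp add: bracket_sum_left[OF assms] bracket_scale_left[OF assms])
  also have "\<dots> = (\<Sum>i\<in>UNIV. \<Sum>j\<in>UNIV. (X $ i * Y $ j) *s \<mu> (axis i 1) (axis j 1))"
    by (simp add: bracket_sum_right[OF assms] bracket_scale_right[OF assms] vec.scale_sum_right
        vector_smult_assoc)
  finally show ?thesis .
qed

lemma ad_vec:
  assumes "\<mu> \<in> alt_bilin"
  shows "ad \<mu> X *v Y = \<mu> X Y"
  unfolding ad_def by (rule matrix_works) (use assms in \<open>auto simp: alt_bilin_def\<close>)

text \<open>The structure constants as a point of a Euclidean space, where norms, limits and nearest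
  points make sense.\<close>

definition bracket_tensor :: "('n::finite) bracket \<Rightarrow> complex ^ 'n ^ 'n ^ 'n" where
  "bracket_tensor \<mu> = (\<chi> i j. \<mu> (axis i 1) (axis j 1))"

lemma inner_bracket_tensor:
  "inner (bracket_tensor \<mu>) (bracket_tensor \<nu>) =
     (\<Sum>i\<in>UNIV. \<Sum>j\<in>UNIV. inner (\<mu> (axis i 1) (axis j 1)) (\<nu> (axis i 1) (axis j 1)))"
  by (simp add: inner_vec_def bracket_tensor_def)

lemma norm_bracket_tensor: "norm (bracket_tensor \<mu>) = bracket_norm \<mu>"
proof -
  have h: "hinner v (axis k 1) = v $ k" for v :: "complex ^ 'a" and k
    by (simp add: hinner_def axis_def if_distrib cong: if_cong)
  show ?thesis
    unfolding norm_eq_sqrt_inner inner_bracket_tensor bracket_norm_def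
    by (simp add: bracket_inner_def h inner_vec_def inner_complex_def)
qed

lemma bracket_tensor_eq_iff:
  assumes "\<mu> \<in> alt_bilin" "\<nu> \<in> alt_bilin"
  shows "bracket_tensor \<mu> = bracket_tensor \<nu> \<longleftrightarrow> \<mu> = \<nu>"
proof
  assume "bracket_tensor \<mu> = bracket_tensor \<nu>"
  then have "\<mu> (axis i 1) (axis j 1) = \<nu> (axis i 1) (axis j 1)" for i j
    by (simp add: bracket_tensor_def vec_eq_iff)
  then show "\<mu> = \<nu>"
    by (intro ext) (subst bracket_expand[OF assms(1)], subst bracket_expand[OF assms(2)], simp)
qed simp

text \<open>The derivative at s = 0 of exp(sA) acting on \<open>\<mu>\<close>: the representation of
  gl(n) on brackets.\<close>

definition deriv_act :: "complex ^ 'n ^ 'n \<Rightarrow> ('n::finite) bracket \<Rightarrow> 'n bracket" where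
  "deriv_act A \<mu> = (\<lambda>X Y. A *v \<mu> X Y - \<mu> (A *v X) Y - \<mu> X (A *v Y))"

lemma deriv_act_alt_bilin:
  assumes "\<mu> \<in> alt_bilin"
  shows "deriv_act A \<mu> \<in> alt_bilin"
proof (rule alt_bilinI)
  fix X
  show "deriv_act A \<mu> X X = 0"
    using bracket_skew[OF assms, of X "A *v X"] assms by (simp add: deriv_act_def alt_bilin_def)
qed (simp_all add: deriv_act_def bracket_linear[OF assms] vec.add vec.scale vec.scale_right_diff_distrib)

lemma deriv_act_zero: "deriv_act A (\<lambda>X Y. 0) = (\<lambda>X Y. 0)"
  by (simp add: deriv_act_def)

text \<open>gl(n) acts by a Lie algebra representation. When A is a derivation of
  \<open>\<mu>\<close>, the last term vanishes.\<close>

lemma deriv_act_commutator: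
  assumes "\<mu> \<in> alt_bilin"
  shows "deriv_act A (deriv_act B \<mu>) X Y =
         deriv_act (A ** B - B ** A) \<mu> X Y + deriv_act B (deriv_act A \<mu>) X Y"
  by (simp add: deriv_act_def vec.diff matrix_vector_mult_diff_rdistrib bracket_linear[OF assms]
      flip: matrix_vector_mul_assoc)

text \<open>The adjoint moves across only after summing over the basis: expand A in basis vectors
  and swap the two sums.\<close>

lemma inner_bracket_expand_left:
  assumes "\<mu> \<in> alt_bilin" "\<nu> \<in> alt_bilin"
  shows "(\<Sum>i\<in>UNIV. inner (\<mu> (A *v axis i 1) Y) (\<nu> (axis i 1) Y)) =
         (\<Sum>i\<in>UNIV. inner (\<mu> (axis i 1) Y) (\<nu> (hadjoint A *v axis i 1) Y))"
proof -
  have c: "inner (c *s x) y = inner x (cnj c *s y)" for c and x y :: "complex ^ 'a"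
    by (simp add: inner_vec_def inner_complex_def algebra_simps)
  have "(\<Sum>i\<in>UNIV. inner (\<mu> (A *v axis i 1) Y) (\<nu> (axis i 1) Y)) =
        (\<Sum>i\<in>UNIV. \<Sum>l\<in>UNIV. inner (\<mu> (axis l 1) Y) (cnj (A $ l $ i) *s \<nu> (axis i 1) Y))"
    by (simp add: mult_axis_expand bracket_sum_left[OF assms(1)] bracket_scale_left[OF assms(1)]
        inner_sum_left c)
  also have "\<dots> = (\<Sum>l\<in>UNIV. \<Sum>i\<in>UNIV. inner (\<mu> (axis l 1) Y) (cnj (A $ l $ i) *s \<nu> (axis i 1) Y))"
    by (rule sum.swap)
  also have "\<dots> = (\<Sum>i\<in>UNIV. inner (\<mu> (axis i 1) Y) (\<nu> (hadjoint A *v axis i 1) Y))"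
    by (simp add: mult_axis_expand bracket_sum_left[OF assms(2)] bracket_scale_left[OF assms(2)]
        inner_sum_right hadjoint_def)
  finally show ?thesis .
qed

lemma inner_bracket_expand_right:
  assumes "\<mu> \<in> alt_bilin" "\<nu> \<in> alt_bilin"
  shows "(\<Sum>j\<in>UNIV. inner (\<mu> X (A *v axis j 1)) (\<nu> X (axis j 1))) =
         (\<Sum>j\<in>UNIV. inner (\<mu> X (axis j 1)) (\<nu> X (hadjoint A *v axis j 1)))"
  using inner_bracket_expand_left[OF assms, of A X]
  by (simp add: bracket_skew[OF assms(1), of X] bracket_skew[OF assms(2), of X])

lemma inner_deriv_act:
  assumes "\<mu> \<in> alt_bilin" "\<nu> \<in> alt_bilin"
  shows "inner (bracket_tensor (deriv_act A \<mu>)) (bracket_tensor \<nu>) =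
         inner (bracket_tensor \<mu>) (bracket_tensor (deriv_act (hadjoint A) \<nu>))"
proof -
  have 1: "(\<Sum>i\<in>UNIV. \<Sum>j\<in>UNIV. inner (\<mu> (A *v axis i 1) (axis j 1)) (\<nu> (axis i 1) (axis j 1))) =
        (\<Sum>i\<in>UNIV. \<Sum>j\<in>UNIV. inner (\<mu> (axis i 1) (axis j 1)) (\<nu> (hadjoint A *v axis i 1) (axis j 1)))"
    by (subst (1 2) sum.swap) (simp add: inner_bracket_expand_left[OF assms])
  show ?thesis
    by (simp add: inner_bracket_tensor deriv_act_def inner_diff_left inner_diff_right sum_subtractf
        inner_mult_vec_left 1 inner_bracket_expand_right[OF assms])
qed

text \<open>Up to normalisation, \<open>M_op\<close> is the moment map of the \<open>GL(n)\<close>-action.\<close>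

lemma inner_deriv_act_self:
  assumes "\<mu> \<in> alt_bilin"
  shows "inner (bracket_tensor (deriv_act A \<mu>)) (bracket_tensor \<mu>) = inner A (M_op \<mu>) / 2"
proof -
  let ?a = "\<lambda>i. ad \<mu> (axis i 1)"
  let ?R = "\<Sum>i\<in>UNIV. ?a i ** hadjoint (?a i)" and ?L = "\<Sum>i\<in>UNIV. hadjoint (?a i) ** ?a i"
  have v: "\<mu> X Y = ad \<mu> X *v Y" for X Y
    by (simp add: ad_vec[OF assms])
  have 1: "(\<Sum>i\<in>UNIV. \<Sum>j\<in>UNIV. inner (A *v \<mu> (axis i 1) (axis j 1)) (\<mu> (axis i 1) (axis j 1)))
        = inner A ?R"
    by (simp only: v matrix_vector_mul_assoc inner_sum_right flip: inner_matrix_columns)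
      (simp only: inner_matrix_mult_right)
  have 2: "(\<Sum>i\<in>UNIV. \<Sum>j\<in>UNIV. inner (\<mu> (axis i 1) (A *v axis j 1)) (\<mu> (axis i 1) (axis j 1)))
        = inner A ?L"
    by (simp only: v matrix_vector_mul_assoc inner_sum_right flip: inner_matrix_columns)
      (simp only: inner_matrix_mult_left)
  \<comment> \<open>Swapping the arguments changes the sign in both entries of the inner product, so
    the first slot gives the same value as the second.\<close>
  have 3: "(\<Sum>i\<in>UNIV. \<Sum>j\<in>UNIV. inner (\<mu> (A *v axis i 1) (axis j 1)) (\<mu> (axis i 1) (axis j 1)))
        = inner A ?L"
  proof -
    have "inner (\<mu> (A *v axis i 1) (axis j 1)) (\<mu> (axis i 1) (axis j 1)) =
          inner (\<mu> (axis j 1) (A *v axis i 1)) (\<mu> (axis j 1) (axis i 1))" for i j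
      using bracket_skew[OF assms, of "axis j 1" "A *v axis i 1"]
        bracket_skew[OF assms, of "axis j 1" "axis i 1"] by simp
    then show ?thesis
      unfolding 2[symmetric] by (subst sum.swap) simp
  qed
  \<comment> \<open>The output slot contributes \<open>?R\<close> and each argument slot
    \<open>- ?L\<close>, which is half the pairing with -4 \<open>?L\<close> + 2
    \<open>?R\<close>.\<close>
  show ?thesis
    unfolding M_op_def
    by (simp add: inner_bracket_tensor deriv_act_def inner_diff_left sum_subtractf 1 2 3
        inner_add_right inner_diff_right)
qed

section \<open>Derivations\<close>

definition derivation :: "('n::finite) bracket \<Rightarrow> complex ^ 'n ^ 'n \<Rightarrow> bool" where
  "derivation \<mu> D \<longleftrightarrow> (\<forall>X Y. D *v \<mu> X Y = \<mu> (D *v X) Y + \<mu> X (D *v Y))"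

lemma derivation_iff_deriv_act: "derivation \<mu> D \<longleftrightarrow> deriv_act D \<mu> = (\<lambda>X Y. 0)"
  by (auto simp: derivation_def deriv_act_def fun_eq_iff algebra_simps)

text \<open>Moving one adjoint across turns the squared norm into the pairing of
  \<open>deriv_act D (deriv_act (hadjoint D) \<mu>)\<close> with \<open>\<mu>\<close>. As D
  annihilates \<open>\<mu>\<close>, only the commutator acts, and the moment map identity
  applies.\<close>

lemma norm_deriv_act_hadjoint:
  assumes "\<mu> \<in> alt_bilin" "derivation \<mu> D"
  shows "(norm (bracket_tensor (deriv_act (hadjoint D) \<mu>)))\<^sup>2 =
         inner (D ** hadjoint D - hadjoint D ** D) (M_op \<mu>) / 2"
proof -
  have D: "deriv_act D \<mu> = (\<lambda>X Y. 0)"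
    using assms(2) by (simp add: derivation_iff_deriv_act)
  let ?\<nu> = "deriv_act (hadjoint D) \<mu>"
  have "deriv_act D ?\<nu> = deriv_act (D ** hadjoint D - hadjoint D ** D) \<mu>"
    by (intro ext) (simp add: deriv_act_commutator[OF assms(1), of D] D deriv_act_zero)
  then have "inner (bracket_tensor (deriv_act D ?\<nu>)) (bracket_tensor \<mu>) =
      inner (D ** hadjoint D - hadjoint D ** D) (M_op \<mu>) / 2"
    by (simp add: inner_deriv_act_self[OF assms(1)])
  then show ?thesis
    by (simp add: inner_deriv_act[OF deriv_act_alt_bilin[OF assms(1)] assms(1)] power2_norm_eq_inner)
qed

lemma derivation_ad:
  assumes "\<mu> \<in> alt_bilin" "jacobi \<mu>"
  shows "derivation \<mu> (ad \<mu> X)"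
proof -
  have "\<mu> X (\<mu> Y Z) = \<mu> (\<mu> X Y) Z + \<mu> Y (\<mu> X Z)" for Y Z
  proof -
    have "\<mu> (\<mu> X Y) Z + \<mu> (\<mu> Y Z) X + \<mu> (\<mu> Z X) Y = 0"
      using assms(2) by (simp add: jacobi_def)
    moreover have "\<mu> (\<mu> Y Z) X = - \<mu> X (\<mu> Y Z)"
      by (rule bracket_skew[OF assms(1)])
    moreover have "\<mu> (\<mu> Z X) Y = \<mu> Y (\<mu> X Z)"
    proof -
      have "\<mu> (\<mu> Z X) Y = - \<mu> Y (\<mu> Z X)"
        by (rule bracket_skew[OF assms(1)])
      moreover have "\<mu> Z X = (-1) *\<^sub>R \<mu> X Z"
        using bracket_skew[OF assms(1), of Z X] by simp
      ultimately show ?thesis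
        by (simp only: bracket_scaleR_right[OF assms(1)]) simp
    qed
    ultimately show ?thesis
      by (simp add: algebra_simps)
  qed
  then show ?thesis
    by (simp add: derivation_def ad_vec[OF assms(1)])
qed

section \<open>The action of GL(n) on Lie brackets\<close>

lemma gl_act_alt_bilin:
  assumes "\<mu> \<in> alt_bilin"
  shows "gl_act g \<mu> \<in> alt_bilin"
proof (rule alt_bilinI)
  show "gl_act g \<mu> X X = 0" for X
    using assms by (simp add: gl_act_def alt_bilin_def)
qed (simp_all add: gl_act_def bracket_linear[OF assms] vec.add vec.scale)

lemma gl_act_mult_vec:
  assumes "invertible g"
  shows "gl_act g \<mu> (g *v X) (g *v Y) = g *v \<mu> X Y"
  by (simp add: gl_act_def matrix_inv_vec[OF assms])

lemma gl_act_jacobi: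
  assumes "invertible g" "jacobi \<mu>"
  shows "jacobi (gl_act g \<mu>)"
  using assms(2)
  by (simp add: jacobi_def gl_act_def matrix_inv_vec[OF assms(1)] flip: vec.add)

lemma gl_act_nonzero:
  assumes "invertible g" "\<mu> \<noteq> (\<lambda>X Y. 0)"
  shows "gl_act g \<mu> \<noteq> (\<lambda>X Y. 0)"
proof
  assume "gl_act g \<mu> = (\<lambda>X Y. 0)"
  then have "g *v \<mu> X Y = 0" for X Y
    using gl_act_mult_vec[OF assms(1), of \<mu> X Y] by simp
  then have "\<mu> X Y = 0" for X Y
    using matrix_inv_vec(2)[OF assms(1), of "\<mu> X Y"] by simp
  with assms(2) show False
    by (auto simp: fun_eq_iff)
qed

lemma lie_variety_memI:
  assumes "\<mu> \<in> alt_bilin" "\<mu> \<noteq> (\<lambda>X Y. 0)" "jacobi \<mu>"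
  shows "proj_class \<mu> \<in> lie_variety"
  using assms unfolding lie_variety_def by blast

text \<open>The Jacobi sum is quadratic in the bracket, so it vanishes for every multiple of a Lie
  bracket.\<close>

lemma jacobi_of_lie_variety:
  assumes "\<mu> \<in> alt_bilin" "proj_class \<mu> \<in> lie_variety"
  shows "jacobi \<mu>"
proof -
  obtain \<nu> where \<nu>: "proj_class \<mu> = proj_class \<nu>" "\<nu> \<in> alt_bilin" "jacobi \<nu>"
    using assms(2) by (auto simp: lie_variety_def)
  have "\<mu> \<in> proj_class \<mu>"
    unfolding proj_class_def by (auto simp: smult_bracket_def intro!: exI[of _ 1])
  then obtain c where c: "\<mu> = smult_bracket c \<nu>"
    unfolding \<nu>(1) by (auto simp: proj_class_def)
  have "(c * c) *s (\<nu> (\<nu> X Y) Z + \<nu> (\<nu> Y Z) X + \<nu> (\<nu> Z X) Y) = 0" for X Y Z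
    using \<nu>(3) by (simp add: jacobi_def)
  then show ?thesis
    unfolding c jacobi_def
    by (simp add: smult_bracket_def bracket_linear[OF \<nu>(2)] vec.scale_right_distrib)
qed


subsection \<open>The functional in terms of the moment map\<close>

text \<open>The identity matrix acts on brackets by 1 - 1 - 1 = -1.\<close>

lemma inner_M_op_mat_1:
  fixes \<mu> :: "('n::finite) bracket"
  assumes "\<mu> \<in> alt_bilin"
  shows "inner (mat 1) (M_op \<mu>) = - 2 * (bracket_norm \<mu>)\<^sup>2"
proof -
  have "bracket_tensor (deriv_act (mat 1) \<mu>) = - bracket_tensor \<mu>"
    by (simp add: bracket_tensor_def deriv_act_def vec_eq_iff)
  then have "- (bracket_norm \<mu>)\<^sup>2 = inner (mat 1) (M_op \<mu>) / 2"
    using inner_deriv_act_self[OF assms, of "mat 1"]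
    by (simp add: power2_norm_eq_inner flip: norm_bracket_tensor)
  then show ?thesis by simp
qed

text \<open>Completing the square: the moment matrix M is hermitian, so tr M^2 is its squared norm,
  and its trace is -2. This holds both Cauchy--Schwarz and its equality case.\<close>

lemma F_fun_eq_distance:
  fixes \<mu> :: "('n::finite) bracket"
  assumes "\<mu> \<in> alt_bilin" "bracket_norm \<mu> = 1"
  shows "F_fun (proj_class \<mu>) =
    4 / CARD('n) + (norm (M_op \<mu> + (2 / CARD('n)) *\<^sub>R mat 1))\<^sup>2"
proof -
  have "F_fun (proj_class \<mu>) = Re (complex_of_real (F_fun (proj_class \<mu>)))"
    by simp
  also have "\<dots> = inner (M_op \<mu> ** M_op \<mu>) (mat 1)"
    unfolding F_fun_eq[OF assms(2)] by (simp add: inner_mat_1_right)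
  also have "\<dots> = inner (M_op \<mu>) (M_op \<mu>)"
    by (simp add: inner_matrix_mult_right M_op_hermitian)
  finally have F: "F_fun (proj_class \<mu>) = inner (M_op \<mu>) (M_op \<mu>)" .
  have "inner (M_op \<mu>) (mat 1) = - 2"
    using inner_M_op_mat_1[OF assms(1)] assms(2) by (simp add: inner_commute)
  then show ?thesis
    unfolding F
    by (simp add: power2_norm_eq_inner inner_add_left inner_add_right inner_self_mat_1
        inner_commute[of "mat 1" "M_op \<mu>"] field_simps)
qed

lemma lie_variety_unit_rep:
  assumes "P \<in> lie_variety"
  obtains \<mu> where "\<mu> \<in> alt_bilin" "bracket_norm \<mu> = 1" "P = proj_class \<mu>"
proof (rule proj_space_unit_rep)
  show "P \<in> proj_space"
    using assms by (auto simp: lie_variety_def proj_space_def)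
qed (rule that)

lemma F_fun_ge:
  fixes P :: "('n::finite) bracket set"
  assumes "P \<in> lie_variety"
  shows "F_fun P \<ge> 4 / CARD('n)"
  using assms by (elim lie_variety_unit_rep) (simp add: F_fun_eq_distance)

lemma M_op_smult: "M_op (smult_bracket c \<mu>) = (cmod c)\<^sup>2 *\<^sub>R M_op \<mu>"
proof -
  have "c * cnj c = (complex_of_real (cmod c))\<^sup>2"
    using complex_norm_square[of c] by simp
  then have 1: "cnj (c * x) * (c * y) = (complex_of_real (cmod c))\<^sup>2 * (cnj x * y)"
    and 2: "(c * y) * cnj (c * x) = (complex_of_real (cmod c))\<^sup>2 * (y * cnj x)" for x y
    by (metis (no_types, opaque_lifting) complex_cnj_mult mult.assoc mult.commute)+
  have ad: "ad (smult_bracket c \<mu>) X $ a $ b = c * ad \<mu> X $ a $ b" for X a b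
    by (simp add: ad_nth smult_bracket_def)
  show ?thesis
    by (simp only: vec_eq_iff M_op_nth vector_scaleR_component ad 1 2 sum_distrib_left[symmetric])
      (simp add: scaleR_conv_of_real algebra_simps)
qed

text \<open>Comparing traces determines c, and shows it to be negative for a nonzero
  bracket.\<close>

lemma M_op_scalar_value:
  fixes \<mu> :: "('n::finite) bracket"
  assumes "\<mu> \<in> alt_bilin" "M_op \<mu> = c *\<^sub>R mat 1"
  shows "c = - 2 * (bracket_norm \<mu>)\<^sup>2 / CARD('n)"
  using inner_M_op_mat_1[OF assms(1)] by (simp add: assms(2) inner_self_mat_1 field_simps)

text \<open>Rescaling \<open>\<mu>\<close> multiplies the moment matrix by a positive real, so being
  scalar can be tested on a unit representative, where the trace forces the value -2/n.\<close>

lemma F_fun_eq_min_iff: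
  fixes \<mu> :: "('n::finite) bracket"
  assumes "\<mu> \<in> alt_bilin" "\<mu> \<noteq> (\<lambda>X Y. 0)"
  shows "F_fun (proj_class \<mu>) = 4 / CARD('n) \<longleftrightarrow> (\<exists>c. M_op \<mu> = c *\<^sub>R mat 1)"
proof -
  have "proj_class \<mu> \<in> proj_space"
    using assms by (auto simp: proj_space_def)
  then obtain \<nu> where \<nu>: "\<nu> \<in> alt_bilin" "bracket_norm \<nu> = 1" "proj_class \<mu> = proj_class \<nu>"
    by (rule proj_space_unit_rep)
  have "\<nu> \<in> proj_class \<nu>"
    unfolding proj_class_def by (auto simp: smult_bracket_def intro!: exI[of _ 1])
  then obtain d where d: "\<nu> = smult_bracket d \<mu>" "d \<noteq> 0"
    unfolding \<nu>(3)[symmetric] by (auto simp: proj_class_def)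
  have "F_fun (proj_class \<mu>) = 4 / CARD('n) \<longleftrightarrow> M_op \<nu> = (- 2 / CARD('n)) *\<^sub>R mat 1"
    unfolding \<nu>(3) F_fun_eq_distance[OF \<nu>(1,2)] by (simp add: eq_neg_iff_add_eq_0)
  also have "\<dots> \<longleftrightarrow> (\<exists>c. M_op \<nu> = c *\<^sub>R mat 1)"
  proof
    assume "\<exists>c. M_op \<nu> = c *\<^sub>R mat 1"
    then obtain c where c: "M_op \<nu> = c *\<^sub>R mat 1" by blast
    show "M_op \<nu> = (- 2 / CARD('n)) *\<^sub>R mat 1"
      using M_op_scalar_value[OF \<nu>(1) c] c \<nu>(2) by simp
  qed blast
  also have "\<dots> \<longleftrightarrow> (\<exists>c. M_op \<mu> = c *\<^sub>R mat 1)"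
  proof
    assume "\<exists>c. M_op \<nu> = c *\<^sub>R mat 1"
    then obtain c where "(cmod d)\<^sup>2 *\<^sub>R M_op \<mu> = c *\<^sub>R mat 1"
      by (auto simp: d(1) M_op_smult)
    then have "inverse ((cmod d)\<^sup>2) *\<^sub>R (cmod d)\<^sup>2 *\<^sub>R M_op \<mu> = inverse ((cmod d)\<^sup>2) *\<^sub>R c *\<^sub>R mat 1"
      by simp
    then show "\<exists>c. M_op \<mu> = c *\<^sub>R mat 1"
      using d(2) by auto
  qed (auto simp: d(1) M_op_smult)
  finally show ?thesis .
qed


subsection \<open>Scalar moment map implies semisimplicity\<close>

text \<open>The commutator of D with its adjoint is traceless, hence orthogonal to a scalar moment
  matrix.\<close>

lemma derivation_hadjoint:
  assumes "\<mu> \<in> alt_bilin" "M_op \<mu> = c *\<^sub>R mat 1" "derivation \<mu> D"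
  shows "derivation \<mu> (hadjoint D)"
proof -
  have "inner (D ** hadjoint D - hadjoint D ** D) (mat 1) = 0"
    by (subst inner_diff_left) (simp only: inner_mat_1_right trace_commute[of D] diff_self)
  then have "bracket_tensor (deriv_act (hadjoint D) \<mu>) = 0"
    using norm_deriv_act_hadjoint[OF assms(1,3)] by (simp add: assms(2))
  moreover have "bracket_tensor (\<lambda>X Y. 0) = 0"
    by (simp add: bracket_tensor_def vec_eq_iff)
  moreover have "(\<lambda>X Y. 0) \<in> alt_bilin"
    by (rule alt_bilinI) auto
  ultimately have "deriv_act (hadjoint D) \<mu> = (\<lambda>X Y. 0)"
    using bracket_tensor_eq_iff[OF deriv_act_alt_bilin[OF assms(1)]] by metis
  then show ?thesis
    by (simp add: derivation_iff_deriv_act)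
qed

lemma sum_matrix_vector: "(\<Sum>i\<in>I. A i) *v x = (\<Sum>i\<in>I. A i *v (x :: complex ^ ('n::finite)))"
  by (induction I rule: infinite_finite_induct) (simp_all add: matrix_vector_mult_add_rdistrib)

text \<open>Every \<open>ad\<close> kills a central X, so only the positive part of the moment
  matrix acts on it and its quadratic form at X is nonnegative. That form is also c times the
  squared norm of X, with c negative.\<close>

lemma centre_trivial:
  assumes "\<mu> \<in> alt_bilin" "M_op \<mu> = c *\<^sub>R mat 1" "c < 0" and X: "\<And>Y. \<mu> X Y = 0"
  shows "X = 0"
proof -
  have ad: "ad \<mu> Y *v X = 0" for Y
    using X[of Y] bracket_skew[OF assms(1), of Y X] by (simp add: ad_vec[OF assms(1)])
  have "inner (M_op \<mu> *v X) X = 2 * (\<Sum>i\<in>UNIV. inner (hadjoint (ad \<mu> (axis i 1)) *v X) (hadjoint (ad \<mu> (axis i 1)) *v X))"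
    by (simp add: M_op_def matrix_vector_mult_diff_rdistrib matrix_vector_mult_add_rdistrib
        scaleR_matrix_vector sum_matrix_vector ad inner_mult_vec_left inner_sum_left
        flip: matrix_vector_mul_assoc)
  also have "\<dots> \<ge> 0"
    by (simp add: sum_nonneg)
  finally have "c * inner X X \<ge> 0"
    by (simp add: assms(2) scaleR_matrix_vector)
  with assms(3) have "inner X X \<le> 0"
    by (simp add: zero_le_mult_iff)
  then show ?thesis
    using inner_ge_zero[of X] inner_eq_zero_iff[of X] by linarith
qed

lemma ad_add: "\<mu> \<in> alt_bilin \<Longrightarrow> ad \<mu> (X + Y) = ad \<mu> X + ad \<mu> Y"
  by (simp add: matrix_eq ad_vec matrix_vector_mult_add_rdistrib bracket_add_left)

lemma ad_scaleR: "\<mu> \<in> alt_bilin \<Longrightarrow> ad \<mu> (r *\<^sub>R X) = r *\<^sub>R ad \<mu> X"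
  by (simp add: matrix_eq ad_vec scaleR_matrix_vector bracket_scaleR_left)

text \<open>A real subspace, as orthogonal decomposition is taken for the real inner
  product.\<close>

lemma subspace_range_ad:
  assumes "\<mu> \<in> alt_bilin"
  shows "subspace (range (ad \<mu>))"
proof (rule linear_subspace_image)
  show "linear (ad \<mu>)"
    by (rule linearI) (simp_all add: ad_add[OF assms] ad_scaleR[OF assms])
qed simp

lemma derivation_diff:
  assumes "\<mu> \<in> alt_bilin" "derivation \<mu> A" "derivation \<mu> B"
  shows "derivation \<mu> (A - B)"
  using assms(2,3)
  by (simp add: derivation_def matrix_vector_mult_diff_rdistrib bracket_linear[OF assms(1)])

text \<open>The inner derivations form an ideal among all derivations.\<close>

lemma commutator_ad:
  assumes "\<mu> \<in> alt_bilin" "derivation \<mu> D"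
  shows "D ** ad \<mu> X - ad \<mu> X ** D = ad \<mu> (D *v X)"
  using assms(2)
  by (simp add: matrix_eq derivation_def matrix_vector_mult_diff_rdistrib ad_vec[OF assms(1)]
      flip: matrix_vector_mul_assoc)

text \<open>The component of \<open>(ad X)\<^sup>*\<close> orthogonal to the ideal of inner derivations is a derivation
  commuting with all of them, hence zero.\<close>

lemma hadjoint_ad:
  assumes "\<mu> \<in> alt_bilin" "jacobi \<mu>" "M_op \<mu> = c *\<^sub>R mat 1" "c < 0"
  obtains Y where "hadjoint (ad \<mu> X) = ad \<mu> Y"
proof -
  let ?W = "range (ad \<mu>)"
  have W: "span ?W = ?W"
    using subspace_range_ad[OF assms(1)] by simp
  obtain A P where "A \<in> span ?W" and P: "\<And>w. w \<in> span ?W \<Longrightarrow> orthogonal P w"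
    and AP: "hadjoint (ad \<mu> X) = A + P"
    using orthogonal_subspace_decomp_exists[of ?W "hadjoint (ad \<mu> X)"] by metis
  then obtain Y where Y: "A = ad \<mu> Y"
    unfolding W by auto
  have orth: "inner P (ad \<mu> Z) = 0" for Z
    using P unfolding W by (auto simp: orthogonal_def)
  have "derivation \<mu> (hadjoint (ad \<mu> X) - A)"
    unfolding Y by (intro derivation_diff derivation_hadjoint[OF assms(1,3)] derivation_ad assms)
  then have dP: "derivation \<mu> P"
    by (simp add: AP)
  have "P *v Z = 0" for Z
  proof (rule centre_trivial[OF assms(1,3,4)])
    have d: "derivation \<mu> (hadjoint (ad \<mu> Z))"
      by (intro derivation_hadjoint[OF assms(1,3)] derivation_ad assms)
    let ?B = "ad \<mu> (P *v Z)" and ?H = "hadjoint (ad \<mu> Z)"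
    \<comment> \<open>\<open>?B\<close> is the commutator of P with \<open>ad \<mu> Z\<close>.
      Moving the latter across leaves P paired with the commutator of \<open>?H\<close> and
      \<open>?B\<close>, which is inner and so orthogonal to P.\<close>
    have "inner ?B ?B = inner (P ** ad \<mu> Z - ad \<mu> Z ** P) ?B"
      by (simp add: commutator_ad[OF assms(1) dP])
    also have "\<dots> = - inner P (?H ** ?B - ?B ** ?H)"
      by (simp add: inner_diff_left inner_diff_right inner_matrix_mult_left[of "ad \<mu> Z"]
          inner_matrix_mult_right[of P])
    also have "\<dots> = 0"
      by (simp add: commutator_ad[OF assms(1) d] orth)
    finally have "?B = 0" by simp
    then show "\<mu> (P *v Z) V = 0" for V
      using ad_vec[OF assms(1), of "P *v Z" V] by simp
  qed
  then have "P = 0"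
    by (simp add: matrix_eq)
  then show thesis
    using that AP Y by simp
qed

text \<open>Let ad Y be the adjoint of ad X. Then P = ad Y ad X maps into I, which ad X kills, so ad
  X P = 0. Since P is the adjoint of ad X times ad X, this gives P = 0, then ad X = 0, and X is
  central.\<close>

lemma no_abelian_ideal:
  assumes "\<mu> \<in> alt_bilin" "jacobi \<mu>" "M_op \<mu> = c *\<^sub>R mat 1" "c < 0"
    and I: "lie_ideal \<mu> I" and ab: "\<And>X Y. X \<in> I \<Longrightarrow> Y \<in> I \<Longrightarrow> \<mu> X Y = 0" and X: "X \<in> I"
  shows "X = 0"
proof (rule centre_trivial[OF assms(1,3,4)])
  fix V
  obtain Y where Y: "hadjoint (ad \<mu> X) = ad \<mu> Y"
    by (rule hadjoint_ad[OF assms(1-4)])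
  have neg: "- Z \<in> I" if "Z \<in> I" for Z
    using that I by (auto simp: lie_ideal_def intro: vec.subspace_neg)
  have XI: "\<mu> X Z \<in> I" for Z
    using I X neg[of "\<mu> Z X"] bracket_skew[OF assms(1), of X Z] by (auto simp: lie_ideal_def)
  have YI: "\<mu> Y (\<mu> X Z) \<in> I" for Z
    using I XI by (auto simp: lie_ideal_def)
  let ?P = "ad \<mu> Y ** ad \<mu> X"
  have "ad \<mu> X ** ?P = 0"
    using ab[OF X YI] by (simp add: matrix_eq ad_vec[OF assms(1)] flip: matrix_vector_mul_assoc)
  moreover have "inner ?P ?P = inner (ad \<mu> X ** ?P) (ad \<mu> X)"
    by (simp only: inner_matrix_mult_left[of "ad \<mu> X"] Y)
  ultimately have "?P = 0"
    by simp
  moreover have "inner (ad \<mu> X) (ad \<mu> X) = inner (mat 1) ?P"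
    using inner_matrix_mult_left[of "ad \<mu> X" "mat 1" "ad \<mu> X"] by (simp only: Y matrix_mul_rid)
  ultimately have "inner (ad \<mu> X) (ad \<mu> X) = 0"
    by simp
  then have "ad \<mu> X = 0" by simp
  then show "\<mu> X V = 0"
    using ad_vec[OF assms(1), of X V] by simp
qed

section \<open>Abelian ideals and semisimplicity\<close>

lemma lie_ideal_derived_series:
  assumes "\<mu> \<in> alt_bilin" "jacobi \<mu>" "lie_ideal \<mu> I"
  shows "lie_ideal \<mu> (derived_series \<mu> I k)"
proof (induction k)
  case (Suc k)
  let ?J = "derived_series \<mu> I k"
  let ?G = "{\<mu> X Y | X Y. X \<in> ?J \<and> Y \<in> ?J}"
  have "\<mu> Z W \<in> vec.span ?G" if "W \<in> vec.span ?G" for Z W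
    using that
  proof (induction rule: vec.span_induct)
    case base
    show ?case
      by (rule vec.subspaceI)
        (auto simp: bracket_linear[OF assms(1)] vec.span_zero vec.span_add vec.span_scale)
  next
    case (step W)
    then obtain X Y where W: "W = \<mu> X Y" and XY: "X \<in> ?J" "Y \<in> ?J" by blast
    have "\<mu> Z X \<in> ?J" "\<mu> Z Y \<in> ?J"
      using Suc.IH XY by (auto simp: lie_ideal_def)
    moreover have "\<mu> Z (\<mu> X Y) = \<mu> (\<mu> Z X) Y + \<mu> X (\<mu> Z Y)"
      using derivation_ad[OF assms(1,2), of Z] by (simp add: derivation_def ad_vec[OF assms(1)])
    ultimately show ?case
      unfolding W mem_Collect_eq using XY by (metis (mono_tags, lifting) mem_Collect_eq vec.span_add vec.span_base)
  qed
  then show ?case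
    by (simp add: lie_ideal_def)
qed (use assms in simp)

text \<open>If one term of the derived series of an ideal vanishes, the term before it is an abelian
  ideal and vanishes too; descend to the ideal itself.\<close>

lemma semisimple_if_no_abelian_ideal:
  assumes "\<mu> \<in> alt_bilin" "jacobi \<mu>"
    and no: "\<And>I X. lie_ideal \<mu> I \<Longrightarrow> (\<And>X Y. X \<in> I \<Longrightarrow> Y \<in> I \<Longrightarrow> \<mu> X Y = 0) \<Longrightarrow> X \<in> I \<Longrightarrow> X = 0"
  shows "semisimple_lie \<mu>"
  unfolding semisimple_lie_def
proof (intro conjI allI impI assms(1,2))
  fix I
  assume I: "lie_ideal \<mu> I \<and> solvable_part \<mu> I"
  \<comment> \<open>The conclusion is equality with \<open>{0}\<close>, so the terms must be known
    to contain 0.\<close>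
  have zero: "0 \<in> derived_series \<mu> I k" for k
    using lie_ideal_derived_series[OF assms(1,2), of I k] I
    by (auto simp: lie_ideal_def dest: vec.subspace_0)
  obtain k where "derived_series \<mu> I k = {0}"
    using I by (auto simp: solvable_part_def)
  then have "derived_series \<mu> I 0 = {0}"
  proof (induction k)
    case (Suc k)
    have "\<mu> X Y = 0" if "X \<in> derived_series \<mu> I k" "Y \<in> derived_series \<mu> I k" for X Y
      using Suc.prems that vec.span_base[of "\<mu> X Y" "{\<mu> X Y | X Y. X \<in> derived_series \<mu> I k \<and> Y \<in> derived_series \<mu> I k}"]
      by auto
    then have "X = 0" if "X \<in> derived_series \<mu> I k" for X
      using no[OF lie_ideal_derived_series[OF assms(1,2)]] I that by blast
    then have "derived_series \<mu> I k = {0}"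
      using zero[of k] by blast
    then show ?case by (rule Suc.IH)
  qed
  then show "I = {0}" by simp
qed

text \<open>The image under g of an abelian ideal of \<open>\<mu>\<close> is one of
  \<open>gl_act g \<mu>\<close>, where the scalar moment matrix excludes it.\<close>

lemma semisimple_if_M_op_scalar:
  assumes "\<mu> \<in> alt_bilin" "jacobi \<mu>" "invertible g" "M_op (gl_act g \<mu>) = c *\<^sub>R mat 1" "c < 0"
  shows "semisimple_lie \<mu>"
proof (rule semisimple_if_no_abelian_ideal[OF assms(1,2)])
  fix I X
  assume I: "lie_ideal \<mu> I" and ab: "\<And>X Y. X \<in> I \<Longrightarrow> Y \<in> I \<Longrightarrow> \<mu> X Y = 0" and X: "X \<in> I"
  let ?\<nu> = "gl_act g \<mu>"
  let ?J = "(*v) g ` I"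
  have "lie_ideal ?\<nu> ?J"
    unfolding lie_ideal_def
  proof (intro conjI allI ballI)
    show "vec.subspace ?J"
      using I vec.subspace_image[of I g] by (simp add: lie_ideal_def)
    fix Y Z assume "Z \<in> ?J"
    then obtain Z' where Z: "Z' \<in> I" "Z = g *v Z'" by blast
    have "?\<nu> Y Z = g *v \<mu> (matrix_inv g *v Y) Z'"
      using gl_act_mult_vec[OF assms(3), of \<mu> "matrix_inv g *v Y" Z']
      by (simp only: matrix_inv_vec[OF assms(3)] Z(2))
    then show "?\<nu> Y Z \<in> ?J"
      using I Z(1) unfolding lie_ideal_def by blast
  qed
  moreover have "?\<nu> Y Z = 0" if "Y \<in> ?J" "Z \<in> ?J" for Y Z
    using that ab by (auto simp: gl_act_mult_vec[OF assms(3)])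
  ultimately have "g *v X = 0"
    by (rule no_abelian_ideal[OF gl_act_alt_bilin[OF assms(1)] gl_act_jacobi[OF assms(3,2)]
          assms(4,5)]) (assumption | rule imageI[OF X])+
  then show "X = 0"
    using matrix_inv_vec(2)[OF assms(3), of X] by simp
qed

subsection \<open>Limits\<close>

lemma tendsto_matrix_vec:
  fixes A :: "'a \<Rightarrow> complex ^ 'n ^ ('n::finite)"
  assumes "(A \<longlongrightarrow> A0) F" "(x \<longlongrightarrow> x0) F"
  shows "((\<lambda>k. A k *v x k) \<longlongrightarrow> A0 *v x0) F"
  unfolding matrix_vector_mult_def
  by (intro tendsto_vec_lambda tendsto_sum tendsto_mult tendsto_vec_nth assms)

lemma tendsto_matrix_mult:
  fixes A :: "'a \<Rightarrow> complex ^ 'n ^ ('n::finite)"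
  assumes "(A \<longlongrightarrow> A0) F" "(B \<longlongrightarrow> B0) F"
  shows "((\<lambda>k. A k ** B k) \<longlongrightarrow> A0 ** B0) F"
  unfolding matrix_matrix_mult_def
  by (intro tendsto_vec_lambda tendsto_sum tendsto_mult tendsto_vec_nth assms)

lemma tendsto_hadjoint:
  assumes "(A \<longlongrightarrow> A0) F"
  shows "((\<lambda>k. hadjoint (A k)) \<longlongrightarrow> hadjoint A0) F"
  unfolding hadjoint_def
  by (intro tendsto_vec_lambda tendsto_cnj tendsto_vec_nth assms)

lemma tendsto_det:
  fixes A :: "'a \<Rightarrow> complex ^ 'n ^ ('n::finite)"
  assumes "(A \<longlongrightarrow> A0) F"
  shows "((\<lambda>k. det (A k)) \<longlongrightarrow> det A0) F"
  unfolding det_def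
  by (intro tendsto_sum tendsto_mult tendsto_prod tendsto_const tendsto_vec_nth assms)

lemma tendsto_smult:
  fixes x :: "'a \<Rightarrow> complex ^ ('n::finite)"
  assumes "(c \<longlongrightarrow> c0) F" "(x \<longlongrightarrow> x0) F"
  shows "((\<lambda>k. c k *s x k) \<longlongrightarrow> c0 *s x0) F"
  unfolding vector_scalar_mult_def
  by (intro tendsto_vec_lambda tendsto_mult tendsto_vec_nth assms)

lemma tendsto_bracket:
  assumes "\<mu> \<in> alt_bilin" "(x \<longlongrightarrow> x0) F" "(y \<longlongrightarrow> y0) F"
  shows "((\<lambda>k. \<mu> (x k) (y k)) \<longlongrightarrow> \<mu> x0 y0) F"
proof -
  have "((\<lambda>k. \<Sum>i\<in>UNIV. \<Sum>j\<in>UNIV. (x k $ i * y k $ j) *s \<mu> (axis i 1) (axis j 1)) \<longlongrightarrow>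
      (\<Sum>i\<in>UNIV. \<Sum>j\<in>UNIV. (x0 $ i * y0 $ j) *s \<mu> (axis i 1) (axis j 1))) F"
    by (intro tendsto_sum tendsto_smult tendsto_mult tendsto_const tendsto_vec_nth assms(2,3))
  then show ?thesis
    by (simp only: bracket_expand[OF assms(1), symmetric])
qed

text \<open>The entries are polynomials in the structure constants and their conjugates.\<close>

lemma tendsto_M_op:
  assumes "((\<lambda>k. bracket_tensor (\<mu> k)) \<longlongrightarrow> bracket_tensor \<mu>0) F"
  shows "((\<lambda>k. M_op (\<mu> k)) \<longlongrightarrow> M_op \<mu>0) F"
proof -
  have t: "ad \<mu> (axis i 1) $ a $ b = bracket_tensor \<mu> $ i $ b $ a" for \<mu> :: "'b bracket" and i a b
    by (simp add: ad_nth bracket_tensor_def)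
  show ?thesis
    by (rule vec_tendstoI, rule vec_tendstoI)
      (simp only: M_op_nth t, intro tendsto_intros tendsto_vec_nth assms)
qed


subsection \<open>The regularised minimisation\<close>

lemma invertible_if_det_unit: "norm (det T) = 1 \<Longrightarrow> invertible (T :: complex ^ 'n ^ ('n::finite))"
  by (auto simp: invertible_det_nz)

lemma gl_act_inv:
  assumes "invertible T"
  shows "gl_act (matrix_inv T) \<mu> X Y = matrix_inv T *v \<mu> (T *v X) (T *v Y)"
  by (simp add: gl_act_def invertible_matrix_inv[OF assms])

lemma mult_gl_act_inv:
  assumes "invertible T"
  shows "T *v gl_act (matrix_inv T) \<mu> X Y = \<mu> (T *v X) (T *v Y)"
  by (simp add: gl_act_inv matrix_inv_vec assms)

definition pullback_pair ::
  "('n::finite) bracket \<Rightarrow> complex ^ 'n ^ 'n \<Rightarrow> complex ^ 'n ^ 'n ^ 'n \<Rightarrow> bool" where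
  "pullback_pair \<mu> T L \<longleftrightarrow> norm (det T) = 1 \<and>
     (\<forall>i j. T *v L $ i $ j = \<mu> (T *v axis i 1) (T *v axis j 1))"

text \<open>T is injective, so its equation determines L: the pairs form the graph of the
  pulled-back structure constants over |det T| = 1.\<close>

lemma pullback_pair_iff:
  "pullback_pair \<mu> T L \<longleftrightarrow>
     norm (det T) = 1 \<and> L = bracket_tensor (gl_act (matrix_inv T) \<mu>)"
proof (cases "norm (det T) = 1")
  case True
  then have T: "invertible T" by (rule invertible_if_det_unit)
  have "T *v x = T *v y \<longleftrightarrow> x = y" for x y
    by (metis matrix_inv_vec(2)[OF T])
  then have "(T *v L $ i $ j = \<mu> (T *v axis i 1) (T *v axis j 1)) \<longleftrightarrow>
      L $ i $ j = gl_act (matrix_inv T) \<mu> (axis i 1) (axis j 1)" for i j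
    unfolding mult_gl_act_inv[OF T, symmetric] .
  then show ?thesis
    using True by (simp add: pullback_pair_def bracket_tensor_def vec_eq_iff[of L]
        vec_eq_iff[of "L $ _"])
qed (simp add: pullback_pair_def)

text \<open>The defining conditions of \<open>pullback_pair\<close> avoid the inverse of \<open>T\<close>, so they are closed.\<close>

lemma pullback_pair_limit:
  assumes "\<mu> \<in> alt_bilin" "\<And>k::nat. pullback_pair \<mu> (T k) (L k)"
    and T: "T \<longlonglongrightarrow> T0" and L: "L \<longlonglongrightarrow> L0"
  shows "pullback_pair \<mu> T0 L0"
  unfolding pullback_pair_def
proof (intro conjI allI)
  have "(\<lambda>k. norm (det (T k))) \<longlonglongrightarrow> norm (det T0)"
    by (intro tendsto_norm tendsto_det T)
  then show "norm (det T0) = 1"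
    using assms(2) by (simp add: pullback_pair_def LIMSEQ_const_iff)
  fix i j
  have "(\<lambda>k. T k *v L k $ i $ j) \<longlonglongrightarrow> T0 *v L0 $ i $ j"
    by (intro tendsto_matrix_vec tendsto_vec_nth T L)
  moreover have "(\<lambda>k. \<mu> (T k *v axis i 1) (T k *v axis j 1)) \<longlonglongrightarrow> \<mu> (T0 *v axis i 1) (T0 *v axis j 1)"
    by (intro tendsto_bracket[OF assms(1)] tendsto_matrix_vec T tendsto_const)
  ultimately show "T0 *v L0 $ i $ j = \<mu> (T0 *v axis i 1) (T0 *v axis j 1)"
    using assms(2) LIMSEQ_unique by (simp add: pullback_pair_def)
qed

text \<open>For positive \<open>\<epsilon>\<close> the penalty term keeps T bounded on sublevel
  sets, which gives a minimiser even where the orbit norm alone would let T escape to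
  infinity.\<close>

definition energy :: "('n::finite) bracket \<Rightarrow> real \<Rightarrow> complex ^ 'n ^ 'n \<Rightarrow> real" where
  "energy \<mu> \<epsilon> T = (norm (bracket_tensor (gl_act (matrix_inv T) \<mu>)))\<^sup>2 + \<epsilon> * (norm T)\<^sup>2"

text \<open>The graph of the pullback is closed, and a nonempty closed set has a point nearest to
  the origin.\<close>

lemma energy_minimiser:
  assumes "\<mu> \<in> alt_bilin" "\<epsilon> > 0"
  obtains T where "norm (det T) = 1" "\<And>T'. norm (det T') = 1 \<Longrightarrow> energy \<mu> \<epsilon> T \<le> energy \<mu> \<epsilon> T'"
proof -
  define r where "r = sqrt \<epsilon>"
  have r: "r > 0" "r\<^sup>2 = \<epsilon>"
    using assms(2) by (simp_all add: r_def)
  \<comment> \<open>Rescaling \<open>T\<close> by \<open>r\<close> turns the energy into a squared norm on the product space.\<close>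
  define S where "S = {p. pullback_pair \<mu> ((1 / r) *\<^sub>R fst p) (snd p)}"
  have "closed S"
    unfolding closed_sequential_limits
  proof (intro allI impI, elim conjE)
    fix p p0 assume p: "\<forall>k. p k \<in> S" "p \<longlonglongrightarrow> p0"
    have "(\<lambda>k. (1 / r) *\<^sub>R fst (p k)) \<longlonglongrightarrow> (1 / r) *\<^sub>R fst p0" "(\<lambda>k. snd (p k)) \<longlonglongrightarrow> snd p0"
      by (intro tendsto_scaleR tendsto_const tendsto_fst tendsto_snd p(2))+
    moreover have "pullback_pair \<mu> ((1 / r) *\<^sub>R fst (p k)) (snd (p k))" for k
      using p(1) unfolding S_def by blast
    ultimately have "pullback_pair \<mu> ((1 / r) *\<^sub>R fst p0) (snd p0)"
      by (rule pullback_pair_limit[OF assms(1), rotated])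
    then show "p0 \<in> S" by (simp add: S_def)
  qed
  have mem: "(r *\<^sub>R T, bracket_tensor (gl_act (matrix_inv T) \<mu>)) \<in> S" if "norm (det T) = 1" for T
    using that r(1) by (simp add: S_def pullback_pair_iff)
  have en: "(norm (r *\<^sub>R T, bracket_tensor (gl_act (matrix_inv T) \<mu>)))\<^sup>2 = energy \<mu> \<epsilon> T" for T
    using r assms(2) by (simp add: norm_Pair energy_def power_mult_distrib)
  have "norm (det (mat 1 :: complex ^ 'n ^ 'n)) = 1" by simp
  from mem[OF this] have "S \<noteq> {}" by blast
  with distance_attains_inf[OF \<open>closed S\<close>] obtain p
    where p: "p \<in> S" "\<And>q. q \<in> S \<Longrightarrow> norm p \<le> norm q"
    by (metis dist_0_norm)
  define T where "T = (1 / r) *\<^sub>R fst p"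
  have T: "norm (det T) = 1" "snd p = bracket_tensor (gl_act (matrix_inv T) \<mu>)"
    using p(1) by (simp_all add: S_def pullback_pair_iff T_def)
  have pT: "p = (r *\<^sub>R T, bracket_tensor (gl_act (matrix_inv T) \<mu>))"
    using r(1) by (simp add: prod_eq_iff T(2)[symmetric]) (simp add: T_def)
  have "energy \<mu> \<epsilon> T \<le> energy \<mu> \<epsilon> T'" if "norm (det T') = 1" for T'
    using p(2)[OF mem[OF that]] unfolding pT en[symmetric]
    by (intro power_mono) auto
  with T(1) that show thesis by blast
qed

text \<open>The right-hand side is a polynomial in s with a minimum at 0, so its linear coefficient
  vanishes. In the application x + s y + ... is the moving bracket and a - s b the moving
  matrix.\<close>

lemma first_order_condition:
  fixes x y z w :: "'a::real_inner" and a b :: "'b::real_inner"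
  assumes "\<And>s. (norm x)\<^sup>2 + \<epsilon> * (norm a)\<^sup>2 \<le>
    (norm (x + s *\<^sub>R y + s\<^sup>2 *\<^sub>R z + s ^ 3 *\<^sub>R w))\<^sup>2 + \<epsilon> * (norm (a - s *\<^sub>R b))\<^sup>2"
  shows "inner y x = \<epsilon> * inner b a"
proof -
  define f where "f s = (inner x x + \<epsilon> * inner a a) + s * (2 * inner y x - 2 * \<epsilon> * inner b a)
    + s\<^sup>2 * (inner y y + 2 * inner x z + \<epsilon> * inner b b) + s ^ 3 * (2 * inner x w + 2 * inner y z)
    + s ^ 4 * (inner z z + 2 * inner y w) + s ^ 5 * (2 * inner z w) + s ^ 6 * inner w w" for s
  have "(norm (x + s *\<^sub>R y + s\<^sup>2 *\<^sub>R z + s ^ 3 *\<^sub>R w))\<^sup>2 + \<epsilon> * (norm (a - s *\<^sub>R b))\<^sup>2 = f s" for s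
    by (simp add: f_def power2_norm_eq_inner inner_add_left inner_add_right inner_diff_left
        inner_diff_right inner_commute[of y x] inner_commute[of z x] inner_commute[of w x]
        inner_commute[of z y] inner_commute[of w y] inner_commute[of w z] inner_commute[of b a])
      (simp add: algebra_simps power2_eq_square power3_eq_cube power4_eq_xxxx eval_nat_numeral)
  with assms have "f 0 \<le> f s" for s
    by (simp add: f_def power2_norm_eq_inner)
  moreover have "(f has_real_derivative (2 * inner y x - 2 * \<epsilon> * inner b a)) (at 0)"
    unfolding f_def by (auto intro!: derivative_eq_intros)
  ultimately have "2 * inner y x - 2 * \<epsilon> * inner b a = 0"
    by (intro DERIV_local_min[of f _ 0 1]) auto
  then show ?thesis by simp
qed

text \<open>For square-zero N the inverse is again linear in s, so variations along N stay
  polynomial.\<close>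

lemma square_zero_unipotent:
  fixes N :: "complex ^ 'n ^ ('n::finite)"
  assumes "N ** N = 0"
  shows "(mat 1 - s *\<^sub>R N) ** (mat 1 + s *\<^sub>R N) = mat 1"
  using assms
  by (simp add: matrix_diff_rdistrib matrix_add_ldistrib matrix_scalar_ac flip: scalar_matrix_assoc)

text \<open>Vary T along T(1 - sN), which keeps |det| = 1. The bracket then moves along a cubic
  curve in s with velocity \<open>deriv_act N\<close> of it, and T moves with velocity -TN.\<close>

lemma energy_critical:
  assumes "\<mu> \<in> alt_bilin" and T: "norm (det T) = 1"
    and min: "\<And>T'. norm (det T') = 1 \<Longrightarrow> energy \<mu> \<epsilon> T \<le> energy \<mu> \<epsilon> T'"
    and N: "N ** N = 0" "\<And>s::real. norm (det (mat 1 - s *\<^sub>R N)) = 1"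
  shows "inner N (M_op (gl_act (matrix_inv T) \<mu>) - (2 * \<epsilon>) *\<^sub>R (hadjoint T ** T)) = 0"
proof -
  let ?\<nu> = "gl_act (matrix_inv T) \<mu>"
  have \<nu>: "?\<nu> \<in> alt_bilin"
    by (rule gl_act_alt_bilin[OF assms(1)])
  have iT: "invertible T"
    by (rule invertible_if_det_unit[OF T])
  let ?x = "bracket_tensor ?\<nu>" and ?y = "bracket_tensor (deriv_act N ?\<nu>)"
  let ?z = "bracket_tensor (\<lambda>X Y. ?\<nu> (N *v X) (N *v Y) - N *v ?\<nu> (N *v X) Y - N *v ?\<nu> X (N *v Y))"
  let ?w = "bracket_tensor (\<lambda>X Y. N *v ?\<nu> (N *v X) (N *v Y))"
  have "inner ?y ?x = \<epsilon> * inner (T ** N) T"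
  proof (rule first_order_condition)
    fix s :: real
    let ?T = "T ** (mat 1 - s *\<^sub>R N)"
    have dT: "norm (det ?T) = 1"
      by (simp add: det_mul norm_mult T N(2))
    have iT': "invertible ?T"
      by (rule invertible_if_det_unit[OF dT])
    have "?T ** ((mat 1 + s *\<^sub>R N) ** matrix_inv T) = T ** ((mat 1 - s *\<^sub>R N) ** (mat 1 + s *\<^sub>R N)) ** matrix_inv T"
      by (simp only: matrix_mul_assoc)
    also have "\<dots> = mat 1"
      by (simp add: square_zero_unipotent[OF N(1)] matrix_inv_mult[OF iT])
    finally have inv: "matrix_inv ?T = (mat 1 + s *\<^sub>R N) ** matrix_inv T"
      by (rule matrix_inv_unique)
    have 1: "gl_act (matrix_inv ?T) \<mu> X Y =
        (mat 1 + s *\<^sub>R N) *v ?\<nu> ((mat 1 - s *\<^sub>R N) *v X) ((mat 1 - s *\<^sub>R N) *v Y)" for X Y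
      unfolding gl_act_inv[OF iT'] gl_act_inv[OF iT] by (simp only: inv matrix_vector_mul_assoc)
    have 2: "(mat 1 + s *\<^sub>R N) *v ?\<nu> ((mat 1 - s *\<^sub>R N) *v X) ((mat 1 - s *\<^sub>R N) *v Y) = ?\<nu> X Y + s *\<^sub>R deriv_act N ?\<nu> X Y
        + s\<^sup>2 *\<^sub>R (?\<nu> (N *v X) (N *v Y) - N *v ?\<nu> (N *v X) Y - N *v ?\<nu> X (N *v Y))
        + s ^ 3 *\<^sub>R (N *v ?\<nu> (N *v X) (N *v Y))" for X Y
      by (simp add: matrix_vector_mult_diff_rdistrib matrix_vector_mult_add_rdistrib
          scaleR_matrix_vector matrix_vector_scaleR bracket_linear[OF \<nu>] deriv_act_def vec.diff vec.add
          scaleR_add_right scaleR_diff_right power2_eq_square power3_eq_cube)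
    have "bracket_tensor (gl_act (matrix_inv ?T) \<mu>) = ?x + s *\<^sub>R ?y + s\<^sup>2 *\<^sub>R ?z + s ^ 3 *\<^sub>R ?w"
      by (simp only: vec_eq_iff bracket_tensor_def vec_lambda_beta vector_add_component
          vector_scaleR_component 1 2 simp_thms)
    moreover have "?T = T - s *\<^sub>R (T ** N)"
      by (simp add: matrix_diff_ldistrib matrix_scalar_ac flip: scalar_matrix_assoc)
    ultimately show "(norm ?x)\<^sup>2 + \<epsilon> * (norm T)\<^sup>2 \<le>
        (norm (?x + s *\<^sub>R ?y + s\<^sup>2 *\<^sub>R ?z + s ^ 3 *\<^sub>R ?w))\<^sup>2 + \<epsilon> * (norm (T - s *\<^sub>R (T ** N)))\<^sup>2"
      using min[OF dT] by (simp add: energy_def)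
  qed
  then show ?thesis
    by (simp add: inner_deriv_act_self[OF \<nu>] inner_diff_right inner_matrix_mult_left)
qed

subsection \<open>Critical points\<close>

definition elem_matrix :: "'n \<Rightarrow> 'n \<Rightarrow> complex \<Rightarrow> complex ^ 'n ^ ('n::finite)" where
  "elem_matrix i j c = (\<chi> a b. if a = i \<and> b = j then c else 0)"

lemma inner_elem_matrix: "inner (elem_matrix i j c) H = inner c (H $ i $ j)"
proof -
  have "inner (elem_matrix i j c) H = (\<Sum>a\<in>UNIV. \<Sum>b\<in>UNIV. if a = i \<and> b = j then inner c (H $ a $ b) else 0)"
    by (simp add: inner_vec_def elem_matrix_def if_distrib[of "\<lambda>z. inner z _"] cong: if_cong)
  also have "\<dots> = (\<Sum>a\<in>UNIV. if a = i then inner c (H $ a $ j) else 0)"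
    by (intro sum.cong refl) (simp add: if_distrib cong: if_cong)
  finally show ?thesis by simp
qed

lemma elem_matrix_mult:
  "elem_matrix i j c ** elem_matrix k l d = (if j = k then elem_matrix i l (c * d) else 0)"
proof -
  have "(\<Sum>m\<in>UNIV. (if a = i \<and> m = j then c else 0) * (if m = k \<and> b = l then d else 0)) =
      (\<Sum>m\<in>UNIV. if m = j then (if a = i \<and> j = k \<and> b = l then c * d else 0) else 0)" for a b
    by (rule sum.cong) auto
  then show ?thesis
    by (simp add: elem_matrix_def matrix_matrix_mult_def vec_eq_iff)
qed

lemma elem_matrix_scaleR: "s *\<^sub>R elem_matrix i j c = elem_matrix i j (s *\<^sub>R c)"
  by (simp add: elem_matrix_def vec_eq_iff)

lemma elem_matrix_minus: "- elem_matrix i j c = elem_matrix i j (- c)"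
  by (simp add: elem_matrix_def vec_eq_iff)

lemma det_transvection:
  assumes "i \<noteq> j"
  shows "det (mat 1 + elem_matrix i j c) = 1"
proof -
  have "mat 1 + elem_matrix i j c =
      (\<chi> k. if k = i then row i (mat 1) + c *s row j (mat 1) else row k (mat 1))"
    using assms by (auto simp: vec_eq_iff elem_matrix_def row_def mat_def)
  then show ?thesis
    using det_row_operation[OF assms, of "mat 1" c] by simp
qed

text \<open>Tested against the \<open>E\<^sub>i\<^sub>j\<close>, \<open>H\<close> is diagonal; tested against a conjugate
  \<open>E\<^sub>i\<^sub>j + E\<^sub>j\<^sub>j - E\<^sub>i\<^sub>i - E\<^sub>j\<^sub>i\<close>, its diagonal entries agree.\<close>

lemma scalar_if_orthogonal_to_square_zero:
  fixes H :: "complex ^ 'n ^ ('n::finite)"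
  assumes herm: "hadjoint H = H"
    and orth: "\<And>N. N ** N = 0 \<Longrightarrow> (\<And>s::real. norm (det (mat 1 - s *\<^sub>R N)) = 1) \<Longrightarrow> inner N H = 0"
  shows "\<exists>c. H = c *\<^sub>R mat 1"
proof -
  have det: "det (mat 1 - s *\<^sub>R elem_matrix i j c) = 1" if "i \<noteq> j" for i j c and s :: real
    using det_transvection[OF that, of "- (s *\<^sub>R c)"]
    by (simp only: elem_matrix_scaleR elem_matrix_minus[symmetric] add_uminus_conv_diff)
  have off: "H $ i $ j = 0" if "i \<noteq> j" for i j
  proof -
    \<comment> \<open>Taking the entry itself as coefficient makes the pairing equal to its squared
      modulus.\<close>
    have "inner (elem_matrix i j (H $ i $ j)) H = 0"
      using that by (intro orth) (simp_all add: elem_matrix_mult det)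
    then show ?thesis by (simp add: inner_elem_matrix)
  qed
  have diag: "Re (H $ i $ i) = Re (H $ j $ j)" for i j
  proof (cases "i = j")
    case False
    \<comment> \<open>\<open>?S'\<close> is the inverse of \<open>?S\<close>, so conjugation
      preserves both the square-zero property and the determinants.\<close>
    let ?E = "elem_matrix i j 1" and ?S = "mat 1 + elem_matrix j i 1" and ?S' = "mat 1 - elem_matrix j i 1"
    let ?N = "?S ** ?E ** ?S'"
    have S: "?S' ** ?S = mat 1" "?S ** ?S' = mat 1"
      using False by (simp_all add: matrix_diff_rdistrib matrix_add_ldistrib matrix_diff_ldistrib
          matrix_add_rdistrib elem_matrix_mult)
    have N: "?N = ?E + elem_matrix j j 1 - elem_matrix i i 1 - elem_matrix j i 1"
      using False by (simp add: matrix_add_ldistrib matrix_diff_ldistrib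
          matrix_add_rdistrib elem_matrix_mult)
    have "?N ** ?N = ?S ** ?E ** (?S' ** ?S) ** ?E ** ?S'"
      by (simp only: matrix_mul_assoc)
    also have "\<dots> = ?S ** (?E ** ?E) ** ?S'"
      by (simp only: S matrix_mul_rid matrix_mul_assoc)
    also have "\<dots> = 0"
      using False by (simp add: elem_matrix_mult)
    finally have NN: "?N ** ?N = 0" .
    have "norm (det (mat 1 - s *\<^sub>R ?N)) = 1" for s :: real
    proof -
      have "A ** (mat 1 - s *\<^sub>R E) ** B = A ** B - s *\<^sub>R (A ** E ** B)" for A B E :: "complex ^ 'n ^ 'n"
        by (simp add: matrix_diff_ldistrib matrix_diff_rdistrib matrix_scalar_ac
            flip: scalar_matrix_assoc)
      then have "mat 1 - s *\<^sub>R ?N = ?S ** (mat 1 - s *\<^sub>R ?E) ** ?S'"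
        by (simp only: S)
      then have "det (mat 1 - s *\<^sub>R ?N) = det ?S * det (mat 1 - s *\<^sub>R ?E) * det ?S'"
        by (simp only: det_mul)
      also have "\<dots> = 1"
        using False det[of j i 1 1] by (simp add: det det_transvection)
      finally show ?thesis by simp
    qed
    then have "inner ?N H = 0"
      by (rule orth[OF NN])
    then show ?thesis
      using False unfolding N
      by (simp add: inner_diff_left inner_add_left inner_elem_matrix off inner_complex_def)
  qed simp
  \<comment> \<open>The tests compare only real parts of diagonal entries; hermitian symmetry makes
    these entries real.\<close>
  have im: "Im (H $ i $ i) = 0" for i
  proof -
    have "cnj (H $ i $ i) = H $ i $ i"
      using herm by (simp add: hadjoint_def vec_eq_iff)
    then show ?thesis by (simp add: complex_eq_iff)
  qed
  fix k :: 'n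
  have "H = Re (H $ k $ k) *\<^sub>R mat 1"
    using off diag im by (auto simp: vec_eq_iff mat_def complex_eq_iff)
  then show ?thesis by blast
qed

text \<open>The matrix equation is the critical point condition at a minimiser. The bound compares
  its energy with that of the identity, whose squared norm is n.\<close>

lemma regularised_moment:
  fixes \<mu> :: "('n::finite) bracket"
  assumes "\<mu> \<in> alt_bilin" "\<epsilon> > 0"
  obtains T c where "norm (det T) = 1"
    "M_op (gl_act (matrix_inv T) \<mu>) = c *\<^sub>R mat 1 + (2 * \<epsilon>) *\<^sub>R (hadjoint T ** T)"
    "(norm (bracket_tensor (gl_act (matrix_inv T) \<mu>)))\<^sup>2 \<le> (norm (bracket_tensor \<mu>))\<^sup>2 + \<epsilon> * CARD('n)"
proof -
  obtain T where T: "norm (det T) = 1"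
    and min: "\<And>T'. norm (det T') = 1 \<Longrightarrow> energy \<mu> \<epsilon> T \<le> energy \<mu> \<epsilon> T'"
    using energy_minimiser[OF assms] by metis
  let ?H = "M_op (gl_act (matrix_inv T) \<mu>) - (2 * \<epsilon>) *\<^sub>R (hadjoint T ** T)"
  have "hadjoint ?H = ?H"
    by (simp add: hadjoint_diff hadjoint_scaleR hadjoint_mult M_op_hermitian)
  then have "\<exists>c. ?H = c *\<^sub>R mat 1"
    by (rule scalar_if_orthogonal_to_square_zero) (rule energy_critical[OF assms(1) T min])
  then obtain c where "M_op (gl_act (matrix_inv T) \<mu>) = c *\<^sub>R mat 1 + (2 * \<epsilon>) *\<^sub>R (hadjoint T ** T)"
    by (auto simp: algebra_simps)
  moreover have "(norm (bracket_tensor (gl_act (matrix_inv T) \<mu>)))\<^sup>2 \<le> energy \<mu> \<epsilon> T"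
    using assms(2) by (simp add: energy_def)
  moreover have "energy \<mu> \<epsilon> T \<le> energy \<mu> \<epsilon> (mat 1)"
    by (rule min) simp
  moreover have "gl_act (matrix_inv (mat 1)) \<mu> = \<mu>"
    by (simp add: gl_act_def matrix_inv_unique[of "mat 1" "mat 1"])
  then have "energy \<mu> \<epsilon> (mat 1) = (norm (bracket_tensor \<mu>))\<^sup>2 + \<epsilon> * CARD('n)"
    by (simp add: energy_def power2_norm_eq_inner inner_self_mat_1)
  ultimately show thesis
    using T that by force
qed

subsection \<open>Letting the regularisation tend to zero\<close>

text \<open>The commutator of D with its adjoint is orthogonal to the scalar part, and its pairing
  with the moment matrix is twice a squared norm. The rest of that pairing is 2
  \<open>\<epsilon>\<close> times the difference of the two squared norms.\<close>

lemma derivation_norm_le: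
  assumes "\<mu> \<in> alt_bilin" "derivation \<mu> D" "\<epsilon> > 0"
    and M: "M_op \<mu> = c *\<^sub>R mat 1 + (2 * \<epsilon>) *\<^sub>R (hadjoint T ** T)"
  shows "norm (D ** hadjoint T) \<le> norm (T ** D)"
proof -
  let ?C = "D ** hadjoint D - hadjoint D ** D"
  have "inner ?C (mat 1) = 0"
    by (subst inner_diff_left) (simp only: inner_mat_1_right trace_commute[of D] diff_self)
  then have "inner ?C (M_op \<mu>) = 2 * \<epsilon> * inner ?C (hadjoint T ** T)"
    by (simp only: M inner_add_right inner_scaleR_right)
  then have "0 \<le> \<epsilon> * inner ?C (hadjoint T ** T)"
    using norm_deriv_act_hadjoint[OF assms(1,2)] zero_le_power2[of "norm (bracket_tensor (deriv_act (hadjoint D) \<mu>))"]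
    by linarith
  then have "0 \<le> inner ?C (hadjoint T ** T)"
    using assms(3) by (simp add: zero_le_mult_iff)
  moreover have "inner (D ** hadjoint D) (hadjoint T ** T) = inner (T ** D) (T ** D)"
    by (simp only: inner_matrix_mult_right[of D] inner_matrix_mult_left[of T] hadjoint_hadjoint matrix_mul_assoc)
  moreover have "inner (hadjoint D ** D) (hadjoint T ** T) = inner (D ** hadjoint T) (D ** hadjoint T)"
    by (simp only: inner_matrix_mult_right[of D "hadjoint T"] inner_matrix_mult_left[of "hadjoint D"]
        hadjoint_hadjoint matrix_mul_assoc)
  ultimately have "(norm (D ** hadjoint T))\<^sup>2 \<le> (norm (T ** D))\<^sup>2"
    by (simp add: inner_diff_left power2_norm_eq_inner)
  then show ?thesis
    by (rule power2_le_imp_le) simp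
qed

lemma derivation_conj:
  assumes "invertible T" "\<mu> \<in> alt_bilin" "derivation \<mu> D"
  shows "derivation (gl_act (matrix_inv T) \<mu>) (matrix_inv T ** D ** T)"
  unfolding derivation_def
proof (intro allI)
  fix X Y
  let ?D = "matrix_inv T ** D ** T" and ?\<nu> = "gl_act (matrix_inv T) \<mu>"
  have TD: "T *v (?D *v Z) = D *v (T *v Z)" for Z
    by (simp add: matrix_inv_vec[OF assms(1)] flip: matrix_vector_mul_assoc)
  have "T *v (?D *v ?\<nu> X Y) = T *v (?\<nu> (?D *v X) Y + ?\<nu> X (?D *v Y))"
    using assms(3) by (simp only: TD vec.add mult_gl_act_inv[OF assms(1)] derivation_def)
  then show "?D *v ?\<nu> X Y = ?\<nu> (?D *v X) Y + ?\<nu> X (?D *v Y)"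
    by (metis matrix_inv_vec(2)[OF assms(1)])
qed

text \<open>U and U times its adjoint have the same range: a vector U z orthogonal to the smaller
  range is killed by the adjoint, hence orthogonal to itself. This turns a limit identity for
  \<open>D ** U ** hadjoint U\<close> into invariance of the range of U.\<close>

lemma range_mult_hadjoint:
  fixes U :: "complex ^ 'n ^ ('n::finite)"
  obtains y where "U *v x = U *v (hadjoint U *v y)"
proof -
  let ?W = "range (\<lambda>y. U *v (hadjoint U *v y))"
  have "linear (\<lambda>y. U *v (hadjoint U *v y))"
    by (simp only: matrix_vector_mul_assoc matrix_vector_mul_linear)
  then have W: "span ?W = ?W"
    using linear_subspace_image[of _ UNIV] by simp
  obtain a b where ab: "a \<in> span ?W" "\<And>w. w \<in> span ?W \<Longrightarrow> orthogonal b w" "U *v x = a + b"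
    using orthogonal_subspace_decomp_exists[of ?W "U *v x"] by metis
  from ab(1) obtain y where y: "a = U *v (hadjoint U *v y)"
    unfolding W by blast
  have "inner b (U *v (hadjoint U *v b)) = 0"
    using ab(2) unfolding W by (auto simp: orthogonal_def)
  then have "hadjoint U *v b = 0"
    using inner_mult_vec_right[of b U "hadjoint U *v b"] by simp
  then have "inner b (U *v z) = 0" for z
    by (simp only: inner_mult_vec_right inner_zero_left)
  moreover have "b = U *v (x - hadjoint U *v y)"
    using ab(3) y by (simp add: vec.diff)
  ultimately have "inner b b = 0" by metis
  then show thesis
    using that ab(3) y by simp
qed

lemma semisimple_moment_scalar:
  fixes \<mu> :: "('n::finite) bracket"
  assumes "semisimple_lie \<mu>"
  obtains g c where "invertible g" "M_op (gl_act g \<mu>) = c *\<^sub>R mat 1"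
proof -
  have \<mu>: "\<mu> \<in> alt_bilin" "jacobi \<mu>"
    using assms by (auto simp: semisimple_lie_def)
  define \<epsilon> where "\<epsilon> k = inverse (real (Suc k))" for k
  have \<epsilon>: "\<epsilon> k > 0" "\<epsilon> k \<le> 1" for k
    by (simp_all add: \<epsilon>_def inverse_le_1_iff)
  have "\<forall>k. \<exists>T c. norm (det T) = 1 \<and>
      M_op (gl_act (matrix_inv T) \<mu>) = c *\<^sub>R mat 1 + (2 * \<epsilon> k) *\<^sub>R (hadjoint T ** T) \<and>
      (norm (bracket_tensor (gl_act (matrix_inv T) \<mu>)))\<^sup>2 \<le> (norm (bracket_tensor \<mu>))\<^sup>2 + \<epsilon> k * CARD('n)"
    using regularised_moment[OF \<mu>(1) \<epsilon>(1)] by metis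
  then obtain T c where det: "norm (det (T k)) = 1"
    and M: "M_op (gl_act (matrix_inv (T k)) \<mu>) = c k *\<^sub>R mat 1 + (2 * \<epsilon> k) *\<^sub>R (hadjoint (T k) ** T k)"
    and le: "(norm (bracket_tensor (gl_act (matrix_inv (T k)) \<mu>)))\<^sup>2 \<le> (norm (bracket_tensor \<mu>))\<^sup>2 + \<epsilon> k * CARD('n)" for k
    by metis
  define \<nu> where "\<nu> k = gl_act (matrix_inv (T k)) \<mu>" for k
  have \<nu>: "\<nu> k \<in> alt_bilin" for k
    unfolding \<nu>_def by (rule gl_act_alt_bilin[OF \<mu>(1)])
  have inv: "invertible (T k)" for k
    by (rule invertible_if_det_unit[OF det])
  \<comment> \<open>A bound uniform in k, using \<open>\<epsilon> k \<le> 1\<close>.\<close>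
  define C where "C = sqrt ((norm (bracket_tensor \<mu>))\<^sup>2 + CARD('n))"
  have C: "norm (bracket_tensor (\<nu> k)) \<le> C" for k
  proof -
    have "\<epsilon> k * CARD('n) \<le> CARD('n)"
      using \<epsilon>(2)[of k] by (simp add: mult_left_le_one_le less_imp_le[OF \<epsilon>(1)])
    with le[of k] show ?thesis
      unfolding C_def \<nu>_def by (intro real_le_rsqrt) linarith
  qed
  show thesis
  proof (cases "bounded (range T)")
    case True
    then have "bounded (range T \<times> range (\<lambda>k. bracket_tensor (\<nu> k)))"
      using C by (intro bounded_Times) (auto simp: bounded_iff)
    then have "bounded (range (\<lambda>k. (T k, bracket_tensor (\<nu> k))))"
      by (rule bounded_subset) auto
    then obtain p r where r: "strict_mono r" "((\<lambda>k. (T k, bracket_tensor (\<nu> k))) \<circ> r) \<longlonglongrightarrow> p"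
      using bounded_imp_convergent_subsequence by blast
    then have Tr: "(\<lambda>k. T (r k)) \<longlonglongrightarrow> fst p" and Lr: "(\<lambda>k. bracket_tensor (\<nu> (r k))) \<longlonglongrightarrow> snd p"
      using tendsto_fst[OF r(2)] tendsto_snd[OF r(2)] by (simp_all add: o_def)
    \<comment> \<open>The determinant condition survives the limit, so the limit matrix is
      invertible and the limit bracket stays in the orbit.\<close>
    have "pullback_pair \<mu> (fst p) (snd p)"
      by (rule pullback_pair_limit[OF \<mu>(1) _ Tr Lr]) (simp add: pullback_pair_iff det \<nu>_def)
    then have p: "norm (det (fst p)) = 1" "snd p = bracket_tensor (gl_act (matrix_inv (fst p)) \<mu>)"
      by (simp_all add: pullback_pair_iff)
    let ?M = "M_op (gl_act (matrix_inv (fst p)) \<mu>)"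
    have "\<epsilon> \<longlonglongrightarrow> 0"
      unfolding \<epsilon>_def using LIMSEQ_inverse_real_of_nat .
    then have "(\<lambda>k. \<epsilon> (r k)) \<longlonglongrightarrow> 0"
      using LIMSEQ_subseq_LIMSEQ[OF _ r(1)] by (simp add: o_def)
    then have "(\<lambda>k. M_op (\<nu> (r k)) - (2 * \<epsilon> (r k)) *\<^sub>R (hadjoint (T (r k)) ** T (r k))) \<longlonglongrightarrow>
        ?M - (2 * 0) *\<^sub>R (hadjoint (fst p) ** fst p)"
      using Lr unfolding p(2)
      by (intro tendsto_diff tendsto_M_op tendsto_scaleR tendsto_mult tendsto_const
          tendsto_matrix_mult tendsto_hadjoint Tr)
    then have lim: "(\<lambda>k. c (r k) *\<^sub>R mat 1) \<longlonglongrightarrow> ?M"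
      by (simp add: \<nu>_def M)
    \<comment> \<open>The scalar matrices form a closed set, so convergence of the scalars
      \<open>c (r k)\<close> need not be shown separately.\<close>
    have "?M \<in> span {mat 1}"
      by (rule closed_sequentially[OF closed_span _ lim]) (simp add: span_scale span_base)
    then obtain c0 where "?M = c0 *\<^sub>R mat 1"
      by (auto simp: span_singleton)
    with invertible_matrix_inv(1)[OF invertible_if_det_unit[OF p(1)]] show thesis
      by (rule that)
  next
    case False
    then have "\<forall>j::nat. \<exists>k. real j < norm (T k)"
      unfolding bounded_iff by (metis linorder_not_less rangeE)
    then obtain \<kappa> where \<kappa>: "\<And>j. real j < norm (T (\<kappa> j))" by metis
    have "bounded (range (\<lambda>j. inverse (norm (T (\<kappa> j))) *\<^sub>R T (\<kappa> j)))"
    proof -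
      have "norm (inverse (norm (T (\<kappa> j))) *\<^sub>R T (\<kappa> j)) \<le> 1" for j
        by (cases "T (\<kappa> j) = 0") auto
      then show ?thesis by (auto simp: bounded_iff)
    qed
    then obtain U r where r: "strict_mono r"
      and U: "((\<lambda>j. inverse (norm (T (\<kappa> j))) *\<^sub>R T (\<kappa> j)) \<circ> r) \<longlonglongrightarrow> U"
      using bounded_imp_convergent_subsequence by blast
    define m where "m j = \<kappa> (r j)" for j
    define t where "t j = norm (T (m j))" for j
    define V where "V j = inverse (t j) *\<^sub>R T (m j)" for j
    have VU: "V \<longlonglongrightarrow> U"
      using U by (simp add: V_def[abs_def] t_def m_def o_def)
    \<comment> \<open>The indices \<open>\<kappa> j\<close> are chosen for growth of the norm alone;
      this survives the subsequence because \<open>j \<le> r j\<close>.\<close>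
    have tj: "real j < t j" for j
      using \<kappa>[of "r j"] seq_suble[OF r, of j] unfolding t_def m_def by linarith
    have tpos: "t j > 0" for j
      using tj[of j] by linarith
    have "filterlim t at_top sequentially"
      by (rule filterlim_at_top_mono[OF filterlim_real_sequentially])
        (simp add: less_imp_le[OF tj])
    then have t0: "(\<lambda>j. inverse (t j)) \<longlonglongrightarrow> 0"
      by (rule tendsto_inverse_0_at_top)
    have TV: "T (m j) = t j *\<^sub>R V j" for j
      using tpos[of j] by (simp add: V_def)
    have "norm (V j) = 1" for j
      using tpos[of j] by (simp add: V_def t_def)
    then have normU: "norm U = 1"
      using tendsto_norm[OF VU] by (simp add: LIMSEQ_const_iff)
    \<comment> \<open>The bracket side is quadratic in the matrix and the other side linear, so
      normalising leaves one factor \<open>inverse (t j)\<close>, which tends to 0.\<close>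
    have scaled: "\<mu> (V j *v X) (V j *v Y) = V j *v (inverse (t j) *\<^sub>R \<nu> (m j) X Y)" for j X Y
    proof -
      have "t j *\<^sub>R (V j *v \<nu> (m j) X Y) = \<mu> (T (m j) *v X) (T (m j) *v Y)"
        unfolding \<nu>_def mult_gl_act_inv[OF inv, symmetric] by (simp add: TV scaleR_matrix_vector)
      also have "\<dots> = (t j * t j) *\<^sub>R \<mu> (V j *v X) (V j *v Y)"
        by (simp add: TV scaleR_matrix_vector bracket_linear[OF \<mu>(1)])
      finally have "inverse (t j * t j) *\<^sub>R t j *\<^sub>R (V j *v \<nu> (m j) X Y) =
          inverse (t j * t j) *\<^sub>R (t j * t j) *\<^sub>R \<mu> (V j *v X) (V j *v Y)"
        by (rule arg_cong)
      moreover have "inverse (t j * t j) * t j = inverse (t j)" "inverse (t j * t j) * (t j * t j) = 1"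
        using tpos[of j] by (simp_all add: field_simps)
      ultimately show ?thesis
        by (simp only: scaleR_scaleR scaleR_one matrix_vector_scaleR)
    qed
    have abelian: "\<mu> (U *v X) (U *v Y) = 0" for X Y
    proof -
      let ?\<kappa> = "\<lambda>X Y. \<mu> (U *v X) (U *v Y)"
      \<comment> \<open>The bound C controls the structure constants, so the limit is taken on basis
        vectors and extended bilinearly.\<close>
      have basis: "?\<kappa> (axis a 1) (axis b 1) = 0" for a b
      proof -
        have "(\<lambda>j. inverse (t j) *\<^sub>R \<nu> (m j) (axis a 1) (axis b 1)) \<longlonglongrightarrow> 0"
        proof (rule Lim_null_comparison)
          have "norm (\<nu> (m j) (axis a 1) (axis b 1)) \<le> C" for j
          proof -
            have "norm (\<nu> (m j) (axis a 1) (axis b 1)) = norm (bracket_tensor (\<nu> (m j)) $ a $ b)"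
              by (simp add: bracket_tensor_def)
            also have "\<dots> \<le> norm (bracket_tensor (\<nu> (m j)))"
              by (rule order_trans[OF Finite_Cartesian_Product.norm_nth_le
                    Finite_Cartesian_Product.norm_nth_le])
            finally show ?thesis
              using C[of "m j"] by linarith
          qed
          then show "\<forall>\<^sub>F j in sequentially. norm (inverse (t j) *\<^sub>R \<nu> (m j) (axis a 1) (axis b 1)) \<le> inverse (t j) * C"
            using less_imp_le[OF tpos] by (simp add: mult_left_mono)
          show "(\<lambda>j. inverse (t j) * C) \<longlonglongrightarrow> 0"
            using tendsto_mult[OF t0 tendsto_const[of C]] by simp
        qed
        then have "(\<lambda>j. \<mu> (V j *v axis a 1) (V j *v axis b 1)) \<longlonglongrightarrow> U *v 0"
          unfolding scaled by (rule tendsto_matrix_vec[OF VU])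
        moreover have "(\<lambda>j. \<mu> (V j *v axis a 1) (V j *v axis b 1)) \<longlonglongrightarrow> ?\<kappa> (axis a 1) (axis b 1)"
          by (intro tendsto_bracket[OF \<mu>(1)] tendsto_matrix_vec VU tendsto_const)
        ultimately show ?thesis
          using LIMSEQ_unique by fastforce
      qed
      have "?\<kappa> \<in> alt_bilin"
        using \<mu>(1) by (intro alt_bilinI)
          (simp_all add: vec.add vec.scale bracket_linear[OF \<mu>(1)] alt_bilin_def)
      from bracket_expand[OF this, of X Y] show ?thesis
        by (simp only: basis vec.scale_zero_right sum.neutral_const)
    qed
    have invariant: "\<mu> X (U *v Z) \<in> range ((*v) U)" for X Z
    proof -
      let ?D = "ad \<mu> X"
      define D where "D j = matrix_inv (T (m j)) ** ?D ** T (m j)" for j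
      have TD: "T (m j) ** D j = ?D ** T (m j)" for j
        by (simp add: D_def matrix_mul_assoc matrix_inv_mult[OF inv])
      have VD: "V j ** D j = ?D ** V j" for j
        unfolding V_def by (simp only: scalar_matrix_assoc[symmetric] TD matrix_scalar_ac)
      \<comment> \<open>No bound on \<open>D j\<close> itself is available; only its product with
        the adjoint of \<open>V j\<close> is controlled, and the limit is taken of that
        product.\<close>
      have "norm (D j ** hadjoint (V j)) \<le> norm (?D ** V j)" for j
      proof -
        have "derivation (\<nu> (m j)) (D j)"
          unfolding \<nu>_def D_def by (rule derivation_conj[OF inv \<mu>(1) derivation_ad[OF \<mu>]])
        then have "norm (D j ** hadjoint (T (m j))) \<le> norm (T (m j) ** D j)"
          by (rule derivation_norm_le[OF \<nu> _ \<epsilon>(1)]) (simp add: \<nu>_def M)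
        then have "t j * norm (D j ** hadjoint (V j)) \<le> t j * norm (?D ** V j)"
          using tpos[of j] unfolding TD
          by (simp add: TV hadjoint_scaleR matrix_scalar_ac flip: scalar_matrix_assoc)
        then show ?thesis
          using tpos[of j] by simp
      qed
      moreover have "bounded (range (\<lambda>j. ?D ** V j))"
        by (rule convergent_imp_bounded[OF tendsto_matrix_mult[OF tendsto_const VU]])
      then obtain B where "norm (?D ** V j) \<le> B" for j
        by (auto simp: bounded_iff)
      ultimately have "norm (D j ** hadjoint (V j)) \<le> B" for j
        using order_trans by blast
      then have "bounded (range (\<lambda>j. D j ** hadjoint (V j)))"
        by (auto simp: bounded_iff)
      then obtain E q where q: "strict_mono q" and E: "((\<lambda>j. D j ** hadjoint (V j)) \<circ> q) \<longlonglongrightarrow> E"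
        using bounded_imp_convergent_subsequence by blast
      have Vq: "(\<lambda>j. V (q j)) \<longlonglongrightarrow> U"
        using LIMSEQ_subseq_LIMSEQ[OF VU q] by (simp add: o_def)
      have "(\<lambda>j. V (q j) ** (D (q j) ** hadjoint (V (q j)))) \<longlonglongrightarrow> U ** E"
        using E by (intro tendsto_matrix_mult Vq) (simp add: o_def)
      moreover have "V (q j) ** (D (q j) ** hadjoint (V (q j))) = ?D ** V (q j) ** hadjoint (V (q j))" for j
        by (simp only: matrix_mul_assoc VD)
      moreover have "(\<lambda>j. ?D ** V (q j) ** hadjoint (V (q j))) \<longlonglongrightarrow> ?D ** U ** hadjoint U"
        by (intro tendsto_matrix_mult tendsto_hadjoint tendsto_const Vq)
      ultimately have UE: "U ** E = ?D ** U ** hadjoint U"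
        using LIMSEQ_unique by fastforce
      obtain y where "U *v Z = U *v (hadjoint U *v y)"
        by (rule range_mult_hadjoint)
      then have "\<mu> X (U *v Z) = (?D ** U ** hadjoint U) *v y"
        by (simp add: ad_vec[OF \<mu>(1)] flip: matrix_vector_mul_assoc)
      also have "\<dots> = U *v (E *v y)"
        by (simp add: matrix_vector_mul_assoc UE)
      finally show ?thesis by simp
    qed
    have "lie_ideal \<mu> (range ((*v) U))"
      unfolding lie_ideal_def using vec.subspace_image[of UNIV U] invariant by auto
    moreover have "derived_series \<mu> (range ((*v) U)) 1 = {0}"
    proof -
      have "{\<mu> X Y | X Y. X \<in> range ((*v) U) \<and> Y \<in> range ((*v) U)} \<subseteq> {0}"
        using abelian by auto
      then have "vec.span {\<mu> X Y | X Y. X \<in> range ((*v) U) \<and> Y \<in> range ((*v) U)} \<subseteq> {0}"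
        using vec.span_minimal vec.subspace_single_0 by blast
      then show ?thesis
        using vec.span_zero by auto
    qed
    ultimately have "range ((*v) U) = {0}"
      using assms unfolding semisimple_lie_def solvable_part_def by blast
    then have "U = 0"
      by (auto simp: matrix_eq)
    with normU show thesis by simp
  qed
qed

section \<open>Minimisers on the Lie variety\<close>

lemma semisimple_nonzero:
  assumes "semisimple_lie (\<mu> :: ('n::finite) bracket)"
  shows "\<mu> \<noteq> (\<lambda>X Y. 0)"
proof
  assume 0: "\<mu> = (\<lambda>X Y. 0)"
  have "lie_ideal \<mu> UNIV"
    by (simp add: lie_ideal_def)
  moreover have "{\<mu> X Y | X Y. True} = {0}"
    by (simp add: 0)
  then have "derived_series \<mu> UNIV 1 = {0}"
    by simp
  ultimately have "(UNIV :: (complex ^ 'n) set) = {0}"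
    using assms unfolding semisimple_lie_def solvable_part_def by blast
  \<comment> \<open>The index type is nonempty, so some basis vector exists and the whole space is a
    nonzero ideal.\<close>
  then have "axis undefined 1 = (0 :: complex ^ 'n)" by blast
  then show False by (simp add: axis_eq_0_iff)
qed

theorem theorem4p3:
  fixes \<mu> :: "('n::finite) bracket"
  assumes "\<exists>\<nu> :: 'n bracket. semisimple_lie \<nu>"
    and "\<mu> \<in> alt_bilin" and "\<mu> \<noteq> (\<lambda>X Y. 0)"
    and "proj_class \<mu> \<in> lie_variety"
  shows "((\<exists>P \<in> gl_orbit (proj_class \<mu>). is_arg_min F_fun (\<lambda>Q. Q \<in> lie_variety) P)
            \<longleftrightarrow> semisimple_lie \<mu>) \<and>
         (\<forall>P \<in> gl_orbit (proj_class \<mu>). is_arg_min F_fun (\<lambda>Q. Q \<in> lie_variety) P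
            \<longrightarrow> F_fun P = 4 / real CARD('n))"
proof -
  let ?min = "4 / real CARD('n)"
  have orbit: "gl_orbit (proj_class \<nu>) = {proj_class (gl_act g \<nu>) | g. invertible g}" for \<nu> :: "'n bracket"
    by (simp add: gl_orbit_def proj_act_proj_class)
  \<comment> \<open>Used twice: for the assumed semisimple bracket, to identify the minimum value,
    and for \<open>\<mu>\<close>, to find a minimiser in its orbit.\<close>
  have attained: "\<exists>P \<in> gl_orbit (proj_class \<nu>). P \<in> lie_variety \<and> F_fun P = ?min"
    if ss: "semisimple_lie \<nu>" for \<nu> :: "'n bracket"
  proof -
    have \<nu>: "\<nu> \<in> alt_bilin" "jacobi \<nu>" "\<nu> \<noteq> (\<lambda>X Y. 0)"
      using ss semisimple_nonzero[OF ss] by (auto simp: semisimple_lie_def)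
    obtain g c where g: "invertible g" "M_op (gl_act g \<nu>) = c *\<^sub>R mat 1"
      by (rule semisimple_moment_scalar[OF ss])
    have "gl_act g \<nu> \<in> alt_bilin" "gl_act g \<nu> \<noteq> (\<lambda>X Y. 0)" "jacobi (gl_act g \<nu>)"
      by (intro gl_act_alt_bilin gl_act_nonzero gl_act_jacobi \<nu> g(1))+
    then have "proj_class (gl_act g \<nu>) \<in> lie_variety" "F_fun (proj_class (gl_act g \<nu>)) = ?min"
      using g(2) by (auto intro: lie_variety_memI simp: F_fun_eq_min_iff)
    then show ?thesis
      using g(1) unfolding orbit by blast
  qed
  \<comment> \<open>The assumed semisimple bracket shows that the lower bound 4/n is attained, so
    the minimisers are exactly the points of the variety with that value.\<close>
  then obtain Q :: "'n bracket set" where "Q \<in> lie_variety" "F_fun Q = ?min"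
    using assms(1) by blast
  then have arg_min: "is_arg_min F_fun (\<lambda>Q. Q \<in> lie_variety) P \<longleftrightarrow> P \<in> lie_variety \<and> F_fun P = ?min"
    for P :: "'n bracket set"
    unfolding is_arg_min_def using F_fun_ge by (metis linorder_not_less order_antisym)
  have "semisimple_lie \<mu>" if P: "P \<in> gl_orbit (proj_class \<mu>)" "F_fun P = ?min" for P
  proof -
    obtain g where g: "invertible g" "P = proj_class (gl_act g \<mu>)"
      using P(1) unfolding orbit by blast
    have \<nu>: "gl_act g \<mu> \<in> alt_bilin" "gl_act g \<mu> \<noteq> (\<lambda>X Y. 0)"
      by (intro gl_act_alt_bilin gl_act_nonzero assms(2,3) g(1))+
    obtain c where c: "M_op (gl_act g \<mu>) = c *\<^sub>R mat 1"
      using P(2) F_fun_eq_min_iff[OF \<nu>] g(2) by blast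
    have "c < 0"
      using M_op_scalar_value[OF \<nu>(1) c] bracket_norm_pos[OF \<nu>] by simp
    then show ?thesis
      by (rule semisimple_if_M_op_scalar[OF assms(2) jacobi_of_lie_variety[OF assms(2,4)] g(1) c])
  qed
  then show ?thesis
    using attained arg_min by blast
qed

end
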